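(* (i) Let $p \in (1,\infty]$. If for every $\delta>0$ the inequality \[ \left\lVert \sum_{T \in \mathbb{T}} \chi_T \right\rVert_{L^p(B(0,1) ) } \leq C_{\delta} \] holds for any set $\mathbb{T}$ of $\delta \times \delta \times 1$ $SL_2$ tubes with $\delta$-separated directions in $S^2$, then $\lim_{\delta \to 0} C_{\delta} = \infty$. (ii) Let $U$ be any Borel subset of $S^2 \setminus \{(0,0,\pm 1)\}$ with $\mathcal{H}^2(U) >0$. If, for some fixed $p \in [1, \infty)$, \[ \left\lVert f_{\delta, SL_2}^{*}\right\rVert_{L^p(U) } \leq C_{\delta,U} \|f\|_p \] for all $\delta>0$ and for any non-negative Borel function $f$ on $\mathbb{R}^3$, then $\lim_{\delta \to 0} C_{\delta,U} =\infty$.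
   Context: A line $\ell \subseteq \mathbb{R}^3$ is called an $SL_2$ line if either there exist $a,b,c,d \in \mathbb{R}$ with $ad-bc = 1$ such that $\ell = \{(a,b,0) + \lambda (c,d,1) : \lambda \in \mathbb{R} \}$, or there exist $t_0 \in \mathbb{R}$ and $(c,d) \in \mathbb{R}^2 \setminus \{0\}$ such that $\ell = \{(0,0,t_0) + \lambda (c,d,0) : \lambda \in \mathbb{R} \}$. A $\delta\times\delta\times 1$ tube $T\subseteq\mathbb{R}^3$ is a solid cylinder of length $1$ and radius $\delta$; $\ell(T)$ denotes its centre line and $\operatorname{dir}(T)$ the direction of its centre line. It is an $SL_2$ tube if $\ell(T)$ is an $SL_2$ line. $B(0,1)$ is the unit ball in $\mathbb{R}^3$, $\chi_T$ is the indicator function of $T$, and $\mathcal{H}^2$ is two-dimensional Hausdorff (surface) measure on $S^2$. For a Borel function $f$ on $\mathbb{R}^3$, the $SL_2$ Kakeya maximal function at scale $\delta$ is the function on $S^2\setminus\{(0,0,\pm1)\}$ given by \[ f_{\delta,SL_2}^*(e) = \sup_{T} \frac{1}{m(T)} \int_T |f|, \] where the supremum is over all $\delta\times\delta\times1$ $SL_2$ tubes $T$ with $\operatorname{dir}(T)=e$, and $m$ is Lebesgue measure. The norm $\|f\|_p$ is the $L^p(\mathbb{R}^3)$ norm with respect to Lebesgue measure, and $L^p(U)$ is with respect to $\mathcal{H}^2$. *)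

theory Defs
  imports "HOL-Probability.Probability"
begin

section \<open>Hausdorff measure\<close>

definition hausdorff_premeasure :: "real \<Rightarrow> real \<Rightarrow> 'a::metric_space set \<Rightarrow> ennreal" where
  "hausdorff_premeasure s r A =
     (INF V\<in>{V :: nat \<Rightarrow> 'a set. A \<subseteq> (\<Union>i. V i) \<and> (\<forall>i. bounded (V i) \<and> diameter (V i) \<le> r)}.
        \<Sum>i. ennreal (unit_ball_vol s * (diameter (V i) / 2) powr s))"

text \<open>
  The factor \<^term>\<open>unit_ball_vol s\<close> makes the two-dimensional measure
  agree with surface area.  Only dimensions \<open>s > 0\<close> are meant: since
  \<^prop>\<open>(0::real) powr 0 = 0\<close>, the case \<open>s = 0\<close> does not give the counting measure.
\<close>

definition hausdorff_outer_measure :: "real \<Rightarrow> 'a::metric_space set \<Rightarrow> ennreal" where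
  "hausdorff_outer_measure s A = (SUP r\<in>{0<..}. hausdorff_premeasure s r A)"

definition hausdorff_measure :: "real \<Rightarrow> 'a::metric_space measure" where
  "hausdorff_measure s = measure_of UNIV (sets borel) (hausdorff_outer_measure s)"

text \<open>
  \<^term>\<open>measure_of\<close> yields the null measure unless the given set function is
  countably additive, so we check that it is (Caratheodory's criterion).
\<close>

lemma hausdorff_premeasure_mono:
  assumes "A \<subseteq> B" shows "hausdorff_premeasure s r A \<le> hausdorff_premeasure s r B"
  unfolding hausdorff_premeasure_def using assms by (intro INF_superset_mono) auto

lemma hausdorff_premeasure_antimono:
  assumes "r \<le> r'" shows "hausdorff_premeasure s r' A \<le> hausdorff_premeasure s r A"
  unfolding hausdorff_premeasure_def
  by (rule INF_superset_mono) (auto intro: order_trans[OF _ assms])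

lemma hausdorff_premeasure_empty:
  assumes "r > 0" shows "hausdorff_premeasure s r {} = 0"
proof -
  have "hausdorff_premeasure s r ({} :: 'a set)
      \<le> (\<Sum>i. ennreal (unit_ball_vol s * (diameter ({} :: 'a set) / 2) powr s))"
    unfolding hausdorff_premeasure_def using assms by (intro INF_lower) auto
  then show ?thesis by simp
qed

lemma hausdorff_premeasure_countable_subadditive:
  "hausdorff_premeasure s r (\<Union>i. A i) \<le> (\<Sum>n::nat. hausdorff_premeasure s r (A n))"
proof (rule ennreal_le_epsilon)
  let ?H = "hausdorff_premeasure s r"
  let ?f = "\<lambda>V. ennreal (unit_ball_vol s * (diameter V / 2) powr s)"
  fix e :: real assume "0 < e" "(\<Sum>n. ?H (A n)) < top"
  then have *: "?H (A n) < ?H (A n) + e * (1/2)^Suc n" for n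
    by (auto simp add: less_top dest!: ennreal_suminf_lessD)
  have "\<exists>V. A n \<subseteq> (\<Union>i. V i) \<and> (\<forall>i. bounded (V i) \<and> diameter (V i) \<le> r)
      \<and> (\<Sum>i::nat. ?f (V i)) \<le> ?H (A n) + e * (1/2)^Suc n" for n
  proof -
    obtain V where "A n \<subseteq> (\<Union>i. V i)" "\<forall>i. bounded (V i) \<and> diameter (V i) \<le> r"
      "(\<Sum>i::nat. ?f (V i)) < ?H (A n) + e * (1/2)^Suc n"
      using *[of n] unfolding hausdorff_premeasure_def[of s r "A n"] INF_less_iff by blast
    then show ?thesis by (intro exI[of _ V] conjI) (auto intro: less_imp_le)
  qed
  then obtain B where sub: "\<And>n. A n \<subseteq> (\<Union>i. B n i)"
    and B: "\<And>n i. bounded (B n i) \<and> diameter (B n i) \<le> r"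
    and le: "\<And>n. (\<Sum>i::nat. ?f (B n i)) \<le> ?H (A n) + e * (1/2)^Suc n"
    by metis
  define C where "C = case_prod B o prod_decode"
  have "(\<Union>i. A i) \<subseteq> (\<Union>i. C i)"
    using sub by (auto simp add: C_def subset_eq) (metis prod.case prod_encode_inverse)
  moreover have "bounded (C i) \<and> diameter (C i) \<le> r" for i
    using B by (simp add: C_def split_def)
  ultimately have "?H (\<Union>i. A i) \<le> (\<Sum>i. ?f (C i))"
    unfolding hausdorff_premeasure_def by (intro INF_lower) auto
  also have "\<dots> = (\<Sum>n. \<Sum>i. ?f (B n i))"
    unfolding C_def comp_def
    by (rule suminf_ennreal_2dimen[where f = "\<lambda>p. ?f (case_prod B p)", simplified]) simp
  also have "\<dots> \<le> (\<Sum>n. ?H (A n) + e * (1/2) ^ Suc n)"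
    by (intro suminf_le allI le) auto
  also have "\<dots> = (\<Sum>n. ?H (A n)) + (\<Sum>n. ennreal e * ennreal ((1/2) ^ Suc n))"
    using \<open>0 < e\<close> by (subst suminf_add[symmetric])
      (auto simp del: ennreal_suminf_cmult simp add: ennreal_mult[symmetric])
  also have "\<dots> = (\<Sum>n. ?H (A n)) + e"
    unfolding ennreal_suminf_cmult
    by (subst suminf_ennreal_eq[OF zero_le_power power_half_series]) auto
  finally show "?H (\<Union>i. A i) \<le> (\<Sum>n. ?H (A n)) + e" .
qed

lemma hausdorff_premeasure_additive:
  assumes "r < d" and sep: "\<And>x y. x \<in> A \<Longrightarrow> y \<in> B \<Longrightarrow> d \<le> dist x y"
  shows "hausdorff_premeasure s r A + hausdorff_premeasure s r B \<le> hausdorff_premeasure s r (A \<union> B)"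
proof -
  let ?f = "\<lambda>V. ennreal (unit_ball_vol s * (diameter V / 2) powr s)"
  have "hausdorff_premeasure s r A + hausdorff_premeasure s r B \<le> (\<Sum>i. ?f (V i))"
    if V: "A \<union> B \<subseteq> (\<Union>i. V i)" "\<And>i::nat. bounded (V i) \<and> diameter (V i) \<le> r" for V
  proof -
    define W where "W D i = (if V i \<inter> D = {} then {} else V i)" for D i
    have r: "0 \<le> r" using V(2)[of 0] diameter_ge_0 order_trans by blast
    have "hausdorff_premeasure s r D \<le> (\<Sum>i. ?f (W D i))" if D: "D \<subseteq> A \<union> B" for D
      unfolding hausdorff_premeasure_def
    proof (intro INF_lower CollectI conjI allI)
      show "D \<subseteq> (\<Union>i. W D i)"
      proof
        fix x assume "x \<in> D"
        then obtain i where "x \<in> V i" using V(1) D by blast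
        then show "x \<in> (\<Union>i. W D i)" using \<open>x \<in> D\<close> by (auto simp: W_def)
      qed
    qed (use V(2) r in \<open>auto simp: W_def\<close>)
    then have "hausdorff_premeasure s r A + hausdorff_premeasure s r B
        \<le> (\<Sum>i. ?f (W A i)) + (\<Sum>i. ?f (W B i))"
      by (intro add_mono) auto
    also have "\<dots> = (\<Sum>i. ?f (W A i) + ?f (W B i))"
      by (rule suminf_add) auto
    also have "\<dots> \<le> (\<Sum>i. ?f (V i))"
    proof (intro suminf_le)
      fix i
      have "V i \<inter> A = {} \<or> V i \<inter> B = {}"
      proof (rule ccontr)
        assume "\<not> ?thesis"
        then obtain x y where "x \<in> V i" "x \<in> A" "y \<in> V i" "y \<in> B" by auto
        then show False
          using sep[of x y] diameter_bounded_bound[of "V i" x y] V(2)[of i] \<open>r < d\<close> by auto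
      qed
      then show "?f (W A i) + ?f (W B i) \<le> ?f (V i)" by (auto simp: W_def)
    qed auto
    finally show ?thesis .
  qed
  then show ?thesis
    unfolding hausdorff_premeasure_def[of _ _ "A \<union> B"] by (intro INF_greatest) auto
qed

lemma hausdorff_outer_measure_empty: "hausdorff_outer_measure s {} = 0"
  unfolding hausdorff_outer_measure_def
  by (rule antisym[OF SUP_least]) (auto simp: hausdorff_premeasure_empty)

lemma hausdorff_outer_measure_mono:
  "A \<subseteq> B \<Longrightarrow> hausdorff_outer_measure s A \<le> hausdorff_outer_measure s B"
  unfolding hausdorff_outer_measure_def by (intro SUP_mono') (rule hausdorff_premeasure_mono)

lemma hausdorff_outer_measure_countable_subadditive:
  "hausdorff_outer_measure s (\<Union>i. A i) \<le> (\<Sum>n::nat. hausdorff_outer_measure s (A n))"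
  unfolding hausdorff_outer_measure_def[of s "\<Union>i. A i"]
proof (rule SUP_least)
  fix r :: real assume "r \<in> {0<..}"
  then have "(\<Sum>n. hausdorff_premeasure s r (A n)) \<le> (\<Sum>n. hausdorff_outer_measure s (A n))"
    by (intro suminf_le) (auto simp: hausdorff_outer_measure_def intro: SUP_upper)
  with hausdorff_premeasure_countable_subadditive[of s r A]
  show "hausdorff_premeasure s r (\<Union>i. A i) \<le> (\<Sum>n. hausdorff_outer_measure s (A n))"
    by (rule order_trans)
qed

lemma hausdorff_outer_measure_subadditive:
  "hausdorff_outer_measure s (A \<union> B) \<le> hausdorff_outer_measure s A + hausdorff_outer_measure s B"
proof -
  let ?V = "\<lambda>i::nat. if i = 0 then A else if i = 1 then B else {}"
  have "A \<union> B = (\<Union>i. ?V i)"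
    by (auto split: if_splits intro: exI[of _ 0] exI[of _ 1])
  then have "hausdorff_outer_measure s (A \<union> B) \<le> (\<Sum>i. hausdorff_outer_measure s (?V i))"
    using hausdorff_outer_measure_countable_subadditive[of s ?V] by simp
  also have "\<dots> = (\<Sum>i\<in>{0,1}. hausdorff_outer_measure s (?V i))"
    by (rule suminf_finite) (auto simp: hausdorff_outer_measure_empty)
  finally show ?thesis by simp
qed

lemma hausdorff_outer_measure_additive:
  assumes "d > 0" and sep: "\<And>x y. x \<in> A \<Longrightarrow> y \<in> B \<Longrightarrow> d \<le> dist x y"
  shows "hausdorff_outer_measure s A + hausdorff_outer_measure s B
    \<le> hausdorff_outer_measure s (A \<union> B)"
proof -
  let ?H = "hausdorff_premeasure s"
  have "hausdorff_outer_measure s A + hausdorff_outer_measure s B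
      = (SUP r\<in>{0<..}. ?H r A + ?H r B)"
    unfolding hausdorff_outer_measure_def
  proof (rule SUP_add_directed_ennreal[symmetric])
    fix i j :: real assume "i \<in> {0<..}" "j \<in> {0<..}"
    then show "\<exists>k\<in>{0<..}. ?H i A + ?H j B \<le> ?H k A + ?H k B"
      by (intro bexI[of _ "min i j"] add_mono hausdorff_premeasure_antimono) auto
  qed
  also have "\<dots> \<le> hausdorff_outer_measure s (A \<union> B)"
  proof (rule SUP_least)
    fix r :: real assume r: "r \<in> {0<..}"
    define q where "q = min r (d / 2)"
    have q: "q \<le> r" "q < d" "q > 0" using r \<open>d > 0\<close> by (auto simp: q_def)
    have "?H r A + ?H r B \<le> ?H q A + ?H q B"
      using q by (intro add_mono hausdorff_premeasure_antimono)
    also have "\<dots> \<le> ?H q (A \<union> B)"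
      using q sep by (intro hausdorff_premeasure_additive[of q d]) auto
    also have "\<dots> \<le> hausdorff_outer_measure s (A \<union> B)"
      unfolding hausdorff_outer_measure_def using q by (intro SUP_upper) auto
    finally show "?H r A + ?H r B \<le> hausdorff_outer_measure s (A \<union> B)" .
  qed
  finally show ?thesis .
qed

lemma hausdorff_outer_measure_split_closed:
  fixes C X :: "'a::metric_space set"
  assumes "closed C" "C \<noteq> {}"
  shows "hausdorff_outer_measure s (X \<inter> C) + hausdorff_outer_measure s (X - C)
    \<le> hausdorff_outer_measure s X"
proof (cases "hausdorff_outer_measure s X = \<top>")
  case False
  let ?h = "hausdorff_outer_measure s"
  define D where "D n = {x\<in>X. 1 / (real n + 1) \<le> infdist x C}" for n
  define R where "R n = {x\<in>X. 1 / (real n + 2) \<le> infdist x C \<and> infdist x C < 1 / (real n + 1)}" for n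
  have tri: "infdist x C - infdist y C \<le> dist x y" for x y
    using infdist_triangle[of x C y] by simp
  have alt: "(\<Sum>k<n. ?h (R (2 * k + p))) \<le> ?h (\<Union>k<n. R (2 * k + p))" for n p
  proof (induction n)
    case (Suc n)
    let ?U = "\<Union>k<n. R (2 * k + p)"
    have "?h ?U + ?h (R (2 * n + p)) \<le> ?h (?U \<union> R (2 * n + p))"
    proof (cases "n = 0")
      case False
      let ?m = "real (2 * n + p)"
      show ?thesis
      proof (rule hausdorff_outer_measure_additive)
        show "0 < 1 / ?m - 1 / (?m + 1)" using False by (intro diff_gt_0_iff_gt[THEN iffD2] divide_strict_left_mono) auto
        fix x y assume x: "x \<in> ?U" and y: "y \<in> R (2 * n + p)"
        from x obtain k where k: "k < n" "x \<in> R (2 * k + p)" by auto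
        have "1 / ?m \<le> 1 / (real (2 * k + p) + 2)"
          using k(1) by (intro divide_left_mono) auto
        also have "\<dots> \<le> infdist x C" using k by (simp add: R_def)
        finally show "1 / ?m - 1 / (?m + 1) \<le> dist x y"
          using y tri[of x y] by (simp add: R_def)
      qed
    qed (simp add: hausdorff_outer_measure_empty)
    moreover have "(\<Union>k<Suc n. R (2 * k + p)) = ?U \<union> R (2 * n + p)"
      by (auto simp: less_Suc_eq)
    ultimately show ?case
      using order_trans[OF add_right_mono[OF Suc.IH]] unfolding sum.lessThan_Suc by metis
  qed (simp add: hausdorff_outer_measure_empty)
  have "(\<Sum>k<n. ?h (R k)) \<le> ?h X + ?h X" for n
  proof -
    have "(\<Sum>k<n. ?h (R k)) \<le> (\<Sum>k<2 * n. ?h (R k))"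
      by (intro sum_mono2) auto
    also have "\<dots> = (\<Sum>k<n. ?h (R (2 * k + 0))) + (\<Sum>k<n. ?h (R (2 * k + 1)))"
      by (induction n) (auto simp: algebra_simps)
    also have "\<dots> \<le> ?h (\<Union>k<n. R (2 * k + 0)) + ?h (\<Union>k<n. R (2 * k + 1))"
      by (intro add_mono alt)
    also have "\<dots> \<le> ?h X + ?h X"
      by (intro add_mono hausdorff_outer_measure_mono) (auto simp: R_def)
    finally show ?thesis .
  qed
  then have "(\<Sum>k. ?h (R k)) \<le> ?h X + ?h X"
    by (intro suminf_le_const) auto
  then have fin: "(\<Sum>k. ?h (R k)) \<noteq> \<top>"
    using False by (metis ennreal_add_eq_top neq_top_trans)
  have "(\<Sum>k<n. ?h (R k)) + (?h (X \<inter> C) + ?h (X - C)) \<le> ?h X + (\<Sum>k. ?h (R k))" for n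
  proof -
    have "X - C \<subseteq> D n \<union> (\<Union>k. R (k + n))"
    proof
      fix x assume x: "x \<in> X - C"
      define t where "t = infdist x C"
      have "t > 0"
        using x assms in_closed_iff_infdist_zero[of C x] infdist_nonneg[of x C]
        by (auto simp: t_def)
      define m where "m = (LEAST m. 1 / (real m + 1) \<le> t)"
      obtain m0 where "inverse (real (Suc m0)) < t" using reals_Archimedean[OF \<open>t > 0\<close>] by blast
      then have "1 / (real m0 + 1) \<le> t" by (simp add: field_simps)
      then have m: "1 / (real m + 1) \<le> t" unfolding m_def by (rule LeastI)
      show "x \<in> D n \<union> (\<Union>k. R (k + n))"
      proof (cases "1 / (real n + 1) \<le> t")
        case True
        then show ?thesis using x by (simp add: D_def t_def)
      next
        case False
        have "n < m"
        proof (rule ccontr)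
          assume "\<not> n < m"
          then have "1 / (real n + 1) \<le> 1 / (real m + 1)" by (intro divide_left_mono) auto
          then show False using m False by simp
        qed
        then obtain j where j: "m = Suc j" "n \<le> j" by (cases m) auto
        have "\<not> 1 / (real j + 1) \<le> t"
          using not_less_Least[of j "\<lambda>m. 1 / (real m + 1) \<le> t"] j by (simp add: m_def)
        then have "x \<in> R j" using x m j by (simp add: R_def t_def add.commute)
        then show ?thesis using j(2) by (auto intro: exI[of _ "j - n"])
      qed
    qed
    then have "?h (X - C) \<le> ?h (D n \<union> (\<Union>k. R (k + n)))"
      by (rule hausdorff_outer_measure_mono)
    also have "\<dots> \<le> ?h (D n) + ?h (\<Union>k. R (k + n))"
      by (rule hausdorff_outer_measure_subadditive)
    also have "\<dots> \<le> ?h (D n) + (\<Sum>k. ?h (R (k + n)))"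
      by (intro add_left_mono hausdorff_outer_measure_countable_subadditive)
    finally have 1: "?h (X - C) \<le> ?h (D n) + (\<Sum>k. ?h (R (k + n)))" .
    have "?h (X \<inter> C) + ?h (D n) \<le> ?h ((X \<inter> C) \<union> D n)"
    proof (rule hausdorff_outer_measure_additive)
      show "0 < 1 / (real n + 1)" by simp
      fix x y assume "x \<in> X \<inter> C" "y \<in> D n"
      then show "1 / (real n + 1) \<le> dist x y"
        using infdist_le[of x C y] by (auto simp: D_def dist_commute)
    qed
    also have "\<dots> \<le> ?h X"
      by (intro hausdorff_outer_measure_mono) (auto simp: D_def)
    finally have 2: "?h (X \<inter> C) + ?h (D n) \<le> ?h X" .
    have 3: "(\<Sum>k. ?h (R k)) = (\<Sum>k. ?h (R (k + n))) + (\<Sum>k<n. ?h (R k))"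
      by (intro suminf_offset) auto
    have "(\<Sum>k<n. ?h (R k)) + (?h (X \<inter> C) + ?h (X - C))
        \<le> (\<Sum>k<n. ?h (R k)) + (?h (X \<inter> C) + (?h (D n) + (\<Sum>k. ?h (R (k + n)))))"
      by (intro add_left_mono 1)
    also have "\<dots> = (?h (X \<inter> C) + ?h (D n)) + (\<Sum>k. ?h (R k))"
      unfolding 3 by (simp add: ac_simps)
    also have "\<dots> \<le> ?h X + (\<Sum>k. ?h (R k))"
      by (intro add_right_mono 2)
    finally show ?thesis .
  qed
  then have "(\<Sum>k. ?h (R k)) + (?h (X \<inter> C) + ?h (X - C)) \<le> ?h X + (\<Sum>k. ?h (R k))"
    by (rule ennreal_suminf_bound_add)
  then show ?thesis
    using fin unfolding add.commute[of "?h X"] ennreal_add_left_cancel_le infinity_ennreal_def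
    by blast
qed simp

lemma measure_space_hausdorff:
  "measure_space UNIV (sets borel) (hausdorff_outer_measure s :: 'a::metric_space set \<Rightarrow> ennreal)"
proof -
  let ?h = "hausdorff_outer_measure s :: 'a set \<Rightarrow> ennreal"
  let ?L = "lambda_system UNIV UNIV ?h"
  interpret P: sigma_algebra UNIV "UNIV :: 'a set set"
    using sigma_algebra_Pow[of "UNIV :: 'a set"] by simp
  have "outer_measure_space UNIV ?h"
    by (auto simp: outer_measure_space_def positive_def increasing_def countably_subadditive_def
        hausdorff_outer_measure_empty hausdorff_outer_measure_mono
        hausdorff_outer_measure_countable_subadditive)
  then have L: "measure_space UNIV ?L ?h"
    by (rule P.caratheodory_lemma)
  then interpret L: sigma_algebra UNIV ?L
    by (simp add: measure_space_def)
  have closed: "C \<in> ?L" if "closed C" for C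
  proof (cases "C = {}")
    case False
    have "?h (X \<inter> C) + ?h (X - C) = ?h X" for X
    proof (rule antisym)
      show "?h X \<le> ?h (X \<inter> C) + ?h (X - C)"
        using hausdorff_outer_measure_subadditive[of s "X \<inter> C" "X - C"]
        by (simp add: Int_Diff_Un)
    qed (rule hausdorff_outer_measure_split_closed[OF that False])
    then show ?thesis by (simp add: P.lambda_system_eq)
  qed (use L.empty_sets in simp)
  have "sets borel \<subseteq> ?L"
    unfolding sets_borel
  proof (rule L.sigma_sets_subset, clarify)
    fix S :: "'a set" assume "open S"
    then have "UNIV - (UNIV - S) \<in> ?L"
      by (intro L.compl_sets closed) (auto simp: closed_def Compl_eq_Diff_UNIV[symmetric])
    then show "S \<in> ?L" by (simp add: double_diff)
  qed
  then show ?thesis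
    using measure_down[OF L] sets.sigma_algebra_axioms[of "borel :: 'a measure"] by simp
qed

lemma space_hausdorff_measure [simp]: "space (hausdorff_measure s) = UNIV"
  by (simp add: hausdorff_measure_def)

lemma sets_hausdorff_measure [simp, measurable_cong]: "sets (hausdorff_measure s) = sets borel"
  using sets.sigma_sets_eq[of borel] by (simp add: hausdorff_measure_def)

lemma emeasure_hausdorff_measure:
  "A \<in> sets borel \<Longrightarrow> emeasure (hausdorff_measure s) A = hausdorff_outer_measure s A"
  using measure_space_hausdorff[of s]
  by (intro emeasure_measure_of[OF hausdorff_measure_def]) (auto simp: measure_space_def)


section \<open>Lebesgue norms\<close>

text \<open>Meant for exponents \<open>a > 0\<close>.\<close>

definition ennreal_powr :: "ennreal \<Rightarrow> real \<Rightarrow> ennreal" where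
  "ennreal_powr x a = (if x = \<top> then \<top> else ennreal (enn2real x powr a))"

definition Lp_norm :: "ennreal \<Rightarrow> 'a measure \<Rightarrow> ('a \<Rightarrow> ennreal) \<Rightarrow> ennreal" where
  "Lp_norm p M f =
     (if p = \<top> then esssup M f
      else ennreal_powr (\<integral>\<^sup>+ x. ennreal_powr (f x) (enn2real p) \<partial>M) (1 / enn2real p))"


section \<open>Lines and tubes\<close>

definition line :: "real ^ 3 \<Rightarrow> real ^ 3 \<Rightarrow> (real ^ 3) set" where
  "line m v = {m + t *\<^sub>R v | t. True}"

definition sl2_line :: "(real ^ 3) set \<Rightarrow> bool" where
  "sl2_line l \<longleftrightarrow>
     (\<exists>a b c d. a * d - b * c = 1 \<and> l = line (vector [a, b, 0]) (vector [c, d, 1])) \<or>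
     (\<exists>t0 c d. (c, d) \<noteq> (0, 0) \<and> l = line (vector [0, 0, t0]) (vector [c, d, 0]))"

text \<open>
  A unit-length tube is encoded by its midpoint \<open>m\<close> and a unit vector \<open>e\<close> along its axis.
  Lines are not oriented, so \<open>(m, e)\<close> and \<open>(m, - e)\<close> encode the same tube.
\<close>

type_synonym tube = "(real ^ 3) \<times> (real ^ 3)"

definition centre_line :: "tube \<Rightarrow> (real ^ 3) set" where
  "centre_line T = line (fst T) (snd T)"

definition dir :: "tube \<Rightarrow> real ^ 3" where
  "dir T = snd T"

definition tube_set :: "real \<Rightarrow> tube \<Rightarrow> (real ^ 3) set" where
  "tube_set \<delta> T = {fst T + s *\<^sub>R dir T + v | s v. \<bar>s\<bar> \<le> 1 / 2 \<and> v \<bullet> dir T = 0 \<and> norm v \<le> \<delta>}"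

definition sl2_tube :: "tube \<Rightarrow> bool" where
  "sl2_tube T \<longleftrightarrow> norm (dir T) = 1 \<and> sl2_line (centre_line T)"

text \<open>
  Separation is required for both choices of sign of the direction; in particular a set with
  separated directions contains each tube at most once, and it is finite if it consists of
  tubes with unit directions.
\<close>

definition directions_separated :: "real \<Rightarrow> tube set \<Rightarrow> bool" where
  "directions_separated \<delta> TT \<longleftrightarrow>
     (\<forall>T\<in>TT. \<forall>T'\<in>TT. T \<noteq> T' \<longrightarrow> \<delta> \<le> dist (dir T) (dir T') \<and> \<delta> \<le> dist (dir T) (- dir T'))"


section \<open>The maximal function\<close>

definition sl2_maximal :: "real \<Rightarrow> (real ^ 3 \<Rightarrow> real) \<Rightarrow> real ^ 3 \<Rightarrow> ennreal" where
  "sl2_maximal \<delta> f e =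
     (SUP T\<in>{T. sl2_tube T \<and> dir T = e}.
        (\<integral>\<^sup>+ x\<in>tube_set \<delta> T. ennreal \<bar>f x\<bar> \<partial>lborel) / emeasure lborel (tube_set \<delta> T))"

end

theory Submission
  imports Defs
begin

text \<open>
  The \<open>SL\<^sub>2\<close> lines are the horizontal lines of the contact distribution
  \<open>dt = x dy - y dx\<close>: for an angle \<open>\<theta>\<close> and a slope \<open>h\<close> they are
  \<open>(h sin \<theta> + l cos \<theta>, l sin \<theta> - h cos \<theta>, t + l h)\<close>, with parameter \<open>l\<close> and free height \<open>t\<close>.
  Over a fixed point \<open>(x, y)\<close> the angle determines \<open>l\<close> and \<open>h\<close>, and as \<open>\<theta>\<close> varies the product
  \<open>l h\<close> has derivative \<open>l\<^sup>2 - h\<^sup>2\<close>. Take \<open>t = h\<^sup>2 (\<theta> - \<theta>\<^sub>0) + F(\<theta>)\<close>, where \<open>\<theta>\<^sub>0\<close> is \<open>\<theta>\<close> rounded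
  down to a grid. The first summand cancels \<open>- h\<^sup>2\<close> up to a small error, and \<open>F\<close> is the classical
  Kakeya sawtooth function, for which \<open>F(\<theta>) + s \<theta>\<close> has an image of small measure for every
  bounded \<open>s \<ge> 0\<close>; here \<open>s\<close> is the nearly constant value of \<open>l\<^sup>2\<close>. So all vertical fibres of a union of
  thin tubes in all directions are small, and this union lies in a set \<open>E\<close> of arbitrarily small
  measure. For (ii) test the maximal inequality on the indicator function of \<open>E\<close>. For (i) take about
  \<open>\<delta>\<^sup>-\<^sup>2\<close> of these tubes: the overlap function has integral bounded below and small support.
\<close>

section \<open>The sawtooth function\<close>

text \<open>Level \<open>k\<close> is the grid of step \<open>1 / n ^ (k + 1)\<close>, so level 0
  already has step \<open>1 / n\<close>; it supplies the base angle
  \<open>\<theta>\<^sub>0\<close>.\<close>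

definition grid_floor :: "nat \<Rightarrow> nat \<Rightarrow> real \<Rightarrow> real" where
  "grid_floor n k x = \<lfloor>x * real n ^ (k + 1)\<rfloor> / real n ^ (k + 1)"

lemma grid_floor_le: "n \<ge> 1 \<Longrightarrow> grid_floor n k x \<le> x"
  by (simp add: grid_floor_def field_simps)

lemma le_grid_floor:
  assumes "n \<ge> 1"
  shows "x - grid_floor n k x \<le> 1 / real n ^ (k + 1)"
proof -
  have "x * real n ^ (k + 1) \<le> real_of_int \<lfloor>x * real n ^ (k + 1)\<rfloor> + 1"
    by linarith
  then have "x \<le> (real_of_int \<lfloor>x * real n ^ (k + 1)\<rfloor> + 1) / real n ^ (k + 1)"
    using assms by (simp add: field_simps)
  then show ?thesis
    unfolding grid_floor_def add_divide_distrib by linarith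
qed

text \<open>The grids are nested, so rounding to the finer grid \<open>k\<close> never crosses a
  point of grid \<open>j\<close>. With \<open>y\<close> the coordinate in units of the finer step,
  both floors are \<open>\<lfloor>y\<rfloor> div n ^ (k - j)\<close>.\<close>

lemma grid_floor_grid_floor:
  assumes "n \<ge> 1" "j \<le> k"
  shows "grid_floor n j (grid_floor n k x) = grid_floor n j x"
proof -
  define y where "y = x * real n ^ (k + 1)"
  have n: "real n ^ (k + 1) = real n ^ (j + 1) * real n ^ (k - j)"
    using assms by (simp flip: power_add)
  have pos: "real n ^ m > 0" for m using assms by simp
  have "grid_floor n k x * real n ^ (j + 1) = \<lfloor>y\<rfloor> / real_of_int (int (n ^ (k - j)))"
    unfolding grid_floor_def y_def[symmetric] unfolding n using assms by (simp add: field_simps)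
  moreover have "x * real n ^ (j + 1) = y / real_of_int (int (n ^ (k - j)))"
    unfolding y_def n using assms by (simp add: field_simps)
  ultimately have "\<lfloor>grid_floor n k x * real n ^ (j + 1)\<rfloor> = \<lfloor>x * real n ^ (j + 1)\<rfloor>"
    by (simp only: floor_divide_real_eq_div of_nat_0_le_iff floor_of_int)
  then show ?thesis by (simp add: grid_floor_def)
qed

lemma grid_floor_fine:
  assumes "n \<ge> 1" "k \<le> j"
  shows "grid_floor n j (grid_floor n k x) = grid_floor n k x"
proof -
  have n: "real n ^ (j + 1) = real n ^ (k + 1) * real n ^ (j - k)"
    using assms by (simp flip: power_add)
  have "grid_floor n k x * real n ^ (j + 1) = of_int (\<lfloor>x * real n ^ (k + 1)\<rfloor> * int n ^ (j - k))"
    unfolding n using assms by (simp add: grid_floor_def)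
  then have "\<lfloor>grid_floor n k x * real n ^ (j + 1)\<rfloor> = \<lfloor>x * real n ^ (k + 1)\<rfloor> * int n ^ (j - k)"
    by (simp only: floor_of_int)
  then have "grid_floor n j (grid_floor n k x)
      = real_of_int (\<lfloor>x * real n ^ (k + 1)\<rfloor> * int n ^ (j - k)) / real n ^ (j + 1)"
    unfolding grid_floor_def[of n j] by presburger
  also have "\<dots> = grid_floor n k x"
    unfolding n grid_floor_def using assms by simp
  finally show ?thesis .
qed

text \<open>A superposition of \<open>n\<close> sawtooths of slope \<open>- S / n\<close>, jumping
  on finer and finer grids. Inside a cell of level \<open>k\<close> the first \<open>k\<close> of
  them do not jump and the others stay small, so the effective slope is \<open>- k * S / n\<close>.
  As \<open>k\<close> varies, these slopes approximate every value in \<open>[- S, 0]\<close> up to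
  \<open>S / n\<close>.\<close>

definition kakeya_shift :: "nat \<Rightarrow> real \<Rightarrow> real \<Rightarrow> real" where
  "kakeya_shift n S x = - (S / n) * (\<Sum>j=1..n. x - grid_floor n j x)"

lemma kakeya_shift_bound:
  assumes "n \<ge> 1" "S \<ge> 0"
  shows "\<bar>kakeya_shift n S x\<bar> \<le> S / n"
proof -
  have "x - grid_floor n j x \<le> 1 / n" "0 \<le> x - grid_floor n j x" for j
  proof -
    have "1 / real n ^ (j + 1) \<le> 1 / real n ^ 1"
      using assms by (intro divide_left_mono power_increasing) auto
    then show "x - grid_floor n j x \<le> 1 / n" using le_grid_floor[OF assms(1), of x j] by simp
  qed (use assms grid_floor_le in auto)
  then have "(\<Sum>j=1..n. x - grid_floor n j x) \<le> (\<Sum>j=1..n. 1 / n)"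
    "0 \<le> (\<Sum>j=1..n. x - grid_floor n j x)"
    by (intro sum_mono sum_nonneg; blast)+
  moreover have "(\<Sum>j=1..n. 1 / real n) = 1" using assms by simp
  ultimately have "(\<Sum>j=1..n. x - grid_floor n j x) \<le> 1" "0 \<le> (\<Sum>j=1..n. x - grid_floor n j x)"
    by linarith+
  then have "S / n * (\<Sum>j=1..n. x - grid_floor n j x) \<le> S / n * 1"
    "0 \<le> S / n * (\<Sum>j=1..n. x - grid_floor n j x)"
    using assms by (intro mult_left_mono mult_nonneg_nonneg divide_nonneg_nonneg; simp del: sum_subtractf)+
  then show ?thesis by (simp add: kakeya_shift_def abs_mult del: sum_subtractf)
qed

text \<open>Comparison with the left endpoint \<open>y\<close> of the cell of level
  \<open>k\<close>. The error comes from the levels \<open>j > k\<close>: at most \<open>n\<close>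
  terms, each at most \<open>S / n\<close> times the grid step
  \<open>1 / n ^ (k + 2)\<close>.\<close>

lemma kakeya_shift_variation:
  fixes x S :: real
  assumes "n \<ge> 1" "k \<le> n" "S \<ge> 0"
  defines "y \<equiv> grid_floor n k x"
  shows "\<bar>kakeya_shift n S x - kakeya_shift n S y + k * S / n * (x - y)\<bar> \<le> S / real n ^ (k + 2)"
proof -
  let ?f = "\<lambda>j. x - grid_floor n j x"
  \<comment> \<open>For \<open>j \<le> k\<close> both points round to the same point of grid
    \<open>j\<close>; for \<open>j > k\<close> the point \<open>y\<close> lies on grid
    \<open>j\<close> and contributes 0.\<close>
  have d: "?f j - (y - grid_floor n j y) = (if j \<le> k then x - y else ?f j)" for j
    unfolding y_def using assms grid_floor_grid_floor[of n j k x] grid_floor_fine[of n k j x] by auto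
  have "(\<Sum>j=1..n. ?f j) - (\<Sum>j=1..n. y - grid_floor n j y)
      = (\<Sum>j=1..n. if j \<le> k then x - y else ?f j)"
    unfolding sum_subtractf[symmetric] d by (simp only: d)
  also have "\<dots> = (\<Sum>j\<in>{1..k}. if j \<le> k then x - y else ?f j) + (\<Sum>j\<in>{k+1..n}. if j \<le> k then x - y else ?f j)"
    using assms by (subst sum.union_disjoint[symmetric]) (auto intro!: sum.cong)
  also have "\<dots> = k * (x - y) + (\<Sum>j\<in>{k+1..n}. ?f j)"
    by simp
  finally have e: "(\<Sum>j=1..n. ?f j) - (\<Sum>j=1..n. y - grid_floor n j y)
      = k * (x - y) + (\<Sum>j\<in>{k+1..n}. ?f j)" .
  have "kakeya_shift n S x - kakeya_shift n S y
      = - (S / n) * ((\<Sum>j=1..n. ?f j) - (\<Sum>j=1..n. y - grid_floor n j y))"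
    by (simp only: kakeya_shift_def right_diff_distrib)
  then have eq: "kakeya_shift n S x - kakeya_shift n S y + k * S / n * (x - y)
      = - (S / n) * (\<Sum>j\<in>{k+1..n}. ?f j)"
    unfolding e by (simp only: distrib_left) simp
  have f: "0 \<le> ?f j" "j \<in> {k+1..n} \<Longrightarrow> ?f j \<le> 1 / real n ^ (k + 2)" for j
  proof -
    assume "j \<in> {k+1..n}"
    then have "1 / real n ^ (j + 1) \<le> 1 / real n ^ (k + 2)"
      using assms by (intro divide_left_mono power_increasing) auto
    then show "?f j \<le> 1 / real n ^ (k + 2)"
      using le_grid_floor[OF assms(1), of x j] by linarith
  qed (use assms grid_floor_le in auto)
  have 0: "0 \<le> (\<Sum>j\<in>{k+1..n}. ?f j)"
    using f by (intro sum_nonneg) auto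
  have "(\<Sum>j\<in>{k+1..n}. ?f j) \<le> (n - k) * (1 / real n ^ (k + 2))"
    using sum_bounded_above[of "{k+1..n}" ?f "1 / real n ^ (k + 2)"] f(2) by auto
  also have "\<dots> \<le> n * (1 / real n ^ (k + 2))"
    by (intro mult_right_mono) auto
  finally have "S / n * (\<Sum>j\<in>{k+1..n}. ?f j) \<le> S / n * (n * (1 / real n ^ (k + 2)))"
    using assms by (intro mult_left_mono) auto
  also have "\<dots> = S / real n ^ (k + 2)" using assms by simp
  finally show ?thesis
    unfolding eq using 0 assms by (simp add: abs_mult del: sum_subtractf)
qed

section \<open>Compression of \<open>SL\<^sub>2\<close> tubes\<close>

text \<open>\<open>P\<close> is the height over \<open>(x, y)\<close> without the sawtooth. Its
  derivative is \<open>l^2 + 2 h l (\<theta> - a)\<close>: the \<open>- h^2\<close> in the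
  derivative of \<open>l h\<close> is cancelled by the first summand. The change of
  \<open>l^2\<close> since the angle \<open>a\<close> and the last term are each at most
  \<open>8 R^2 w\<close>, and the mean value theorem concludes.\<close>

lemma rotation_variation:
  fixes x y R a b u v :: real
  defines "l \<equiv> \<lambda>\<theta>. x * cos \<theta> + y * sin \<theta>" and "h \<equiv> \<lambda>\<theta>. x * sin \<theta> - y * cos \<theta>"
  defines "P \<equiv> \<lambda>\<theta>. (h \<theta>)\<^sup>2 * (\<theta> - a) + l \<theta> * h \<theta>"
  assumes "\<bar>x\<bar> \<le> R" "\<bar>y\<bar> \<le> R" "a \<le> u" "u \<le> v" "v \<le> a + w"
  shows "\<bar>P v - P u - (l a)\<^sup>2 * (v - u)\<bar> \<le> 16 * R\<^sup>2 * w * (v - u)"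
proof (cases "u = v")
  case False
  then have "u < v" using assms by simp
  have R: "\<bar>x * c\<bar> \<le> R" "\<bar>y * c\<bar> \<le> R" if "\<bar>c\<bar> \<le> 1" for c
    using that assms mult_mono[of "\<bar>x\<bar>" R "\<bar>c\<bar>" 1] mult_mono[of "\<bar>y\<bar>" R "\<bar>c\<bar>" 1] by (auto simp: abs_mult)
  have lb: "\<bar>l \<theta>\<bar> \<le> 2 * R" for \<theta>
    using R[of "cos \<theta>"] R[of "sin \<theta>"] by (auto simp: l_def)
  have hb: "\<bar>h \<theta>\<bar> \<le> 2 * R" for \<theta>
    using R[of "cos \<theta>"] R[of "sin \<theta>"] by (auto simp: h_def)
  have dl: "(l has_real_derivative - h \<theta>) (at \<theta>)" for \<theta>
    unfolding l_def h_def by (auto intro!: derivative_eq_intros)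
  have dh: "(h has_real_derivative l \<theta>) (at \<theta>)" for \<theta>
    unfolding l_def h_def by (auto intro!: derivative_eq_intros)
  have dP: "(P has_real_derivative (l \<theta>)\<^sup>2 + 2 * h \<theta> * l \<theta> * (\<theta> - a)) (at \<theta>)" for \<theta>
    unfolding P_def
    by (rule derivative_eq_intros dl dh refl | simp)+ (simp add: algebra_simps power2_eq_square)
  obtain z where z: "u < z" "z < v" "P v - P u = (v - u) * ((l z)\<^sup>2 + 2 * h z * l z * (z - a))"
    using MVT2[OF \<open>u < v\<close> dP] by blast
  have "\<bar>l z - l a\<bar> \<le> 2 * R * (z - a)"
  proof (cases "z = a")
    case False
    then have "a < z" using z assms by simp
    then obtain q where "l z - l a = (z - a) * (- h q)"
      using MVT2[OF \<open>a < z\<close> dl] by blast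
    then show ?thesis using hb[of q] \<open>a < z\<close> by (simp add: abs_mult mult.commute)
  qed simp
  also have "\<dots> \<le> 2 * R * w"
    using assms z by (intro mult_left_mono) auto
  finally have "\<bar>l z - l a\<bar> \<le> 2 * R * w" .
  moreover have "\<bar>l z + l a\<bar> \<le> 4 * R" using lb[of z] lb[of a] by linarith
  ultimately have "\<bar>l z - l a\<bar> * \<bar>l z + l a\<bar> \<le> (2 * R * w) * (4 * R)"
    by (intro mult_mono) auto
  then have 1: "\<bar>(l z)\<^sup>2 - (l a)\<^sup>2\<bar> \<le> 8 * R\<^sup>2 * w"
    by (simp add: abs_mult[symmetric] algebra_simps power2_eq_square)
  have "\<bar>h z\<bar> * \<bar>l z\<bar> * \<bar>z - a\<bar> \<le> (2 * R) * (2 * R) * w"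
    using lb[of z] hb[of z] z assms by (intro mult_mono) auto
  then have 2: "\<bar>2 * h z * l z * (z - a)\<bar> \<le> 8 * R\<^sup>2 * w"
    by (simp add: abs_mult power2_eq_square)
  have "P v - P u - (l a)\<^sup>2 * (v - u) = (v - u) * (((l z)\<^sup>2 - (l a)\<^sup>2) + 2 * h z * l z * (z - a))"
    unfolding z(3) by (simp add: algebra_simps)
  then have "\<bar>P v - P u - (l a)\<^sup>2 * (v - u)\<bar> = (v - u) * \<bar>((l z)\<^sup>2 - (l a)\<^sup>2) + 2 * h z * l z * (z - a)\<bar>"
    using \<open>u < v\<close> by (simp add: abs_mult)
  also have "\<dots> \<le> (v - u) * (16 * R\<^sup>2 * w)"
    using 1 2 \<open>u < v\<close> by (intro mult_left_mono) linarith+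
  finally show ?thesis by (simp add: algebra_simps)
qed simp

section \<open>Vertical fibres of the family of lines\<close>

definition sl2_height :: "nat \<Rightarrow> real \<Rightarrow> real \<Rightarrow> real \<Rightarrow> real" where
  "sl2_height n S \<theta> h = h\<^sup>2 * (\<theta> - grid_floor n 0 \<theta>) + kakeya_shift n S \<theta>"

text \<open>Solving the parametrisation for the line of angle \<theta> over \<open>(x, y)\<close>
  gives \<open>h = x sin \<theta> - y cos \<theta>\<close> and
  \<open>l = x cos \<theta> + y sin \<theta>\<close>; this is the height \<open>t + l h\<close> of
  that line above \<open>(x, y)\<close>.\<close>

definition fibre_height :: "nat \<Rightarrow> real \<Rightarrow> real \<Rightarrow> real \<Rightarrow> real \<Rightarrow> real" where
  "fibre_height n S x y \<theta> = sl2_height n S \<theta> (x * sin \<theta> - y * cos \<theta>)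
     + (x * cos \<theta> + y * sin \<theta>) * (x * sin \<theta> - y * cos \<theta>)"

text \<open>On intervals of this level the sawtooth function has slope \<open>- k S / n\<close>, which cancels the
  value of \<open>l\<^sup>2\<close> at the angle \<open>a\<close> up to \<open>S / n\<close>.\<close>

definition fibre_level :: "nat \<Rightarrow> real \<Rightarrow> real \<Rightarrow> real \<Rightarrow> real \<Rightarrow> nat" where
  "fibre_level n S x y a = nat \<lfloor>(x * cos a + y * sin a)\<^sup>2 * n / S\<rfloor>"

text \<open>Since \<open>\<bar>l\<bar> \<le> 2 * R\<close>, the choice \<open>S = 4 * R^2\<close>
  dominates \<open>l^2\<close> and the level is at most \<open>n\<close>. The constant is 24 = 16 +
  4 + 4: the rotation error with window \<open>1 / n\<close>, the finer sawtooth terms, and the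
  mismatch of slopes (at most \<open>S / n\<close>) over one cell.\<close>

lemma fibre_height_variation:
  fixes x y R \<theta> :: real
  assumes "n \<ge> 1" "R > 0" "\<bar>x\<bar> \<le> R" "\<bar>y\<bar> \<le> R"
  defines "S \<equiv> 4 * R\<^sup>2"
  defines "k \<equiv> fibre_level n S x y (grid_floor n 0 \<theta>)"
  shows "k \<le> n"
    and "\<bar>fibre_height n S x y \<theta> - fibre_height n S x y (grid_floor n k \<theta>)\<bar> \<le> 24 * R\<^sup>2 / real n ^ (k + 2)"
proof -
  define a where "a = grid_floor n 0 \<theta>"
  define u where "u = grid_floor n k \<theta>"
  define s where "s = (x * cos a + y * sin a)\<^sup>2"
  have S: "S > 0" using assms by (simp add: S_def)
  have "\<bar>x\<bar> * \<bar>cos a\<bar> \<le> R * 1" "\<bar>y\<bar> * \<bar>sin a\<bar> \<le> R * 1"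
    using assms by (intro mult_mono; simp)+
  then have "\<bar>x * cos a\<bar> \<le> R" "\<bar>y * sin a\<bar> \<le> R"
    by (simp_all add: abs_mult)
  then have "\<bar>x * cos a + y * sin a\<bar> \<le> 2 * R" by linarith
  then have "s \<le> (2 * R)\<^sup>2" unfolding s_def by (rule power2_le_iff_abs_le[THEN iffD2, rotated]) (use assms in auto)
  then have s: "0 \<le> s" "s \<le> S" by (auto simp: s_def S_def power_mult_distrib)
  have "s * n / S \<le> n" using s S by (simp add: field_simps mult_mono)
  then have "\<lfloor>s * n / S\<rfloor> \<le> n" by linarith
  then show k: "k \<le> n" by (simp add: k_def fibre_level_def s_def a_def)
  have "real k = \<lfloor>s * n / S\<rfloor>"
    using s S by (simp add: k_def fibre_level_def s_def a_def)
  then have "k \<le> s * n / S" "s * n / S \<le> k + 1" by linarith+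
  then have ks: "k * S / n \<le> s" "s \<le> k * S / n + S / n"
    using S assms by (auto simp: field_simps)
  have au: "a \<le> u"
  proof -
    have "grid_floor n 0 u = a" unfolding u_def a_def using assms by (intro grid_floor_grid_floor) auto
    then show ?thesis using grid_floor_le[of n 0 u] assms by auto
  qed
  \<comment> \<open>Both \<theta> and \<open>u\<close> have the base angle \<open>a\<close>, so a
    single function \<open>P\<close> describes the two heights.\<close>
  have a': "grid_floor n 0 u = a"
    unfolding u_def a_def using assms by (intro grid_floor_grid_floor) auto
  have u: "u \<le> \<theta>" "\<theta> - u \<le> 1 / real n ^ (k + 1)" and ta: "\<theta> \<le> a + 1 / n"
    using grid_floor_le[OF assms(1), of k \<theta>] le_grid_floor[OF assms(1), of \<theta> k]
      le_grid_floor[OF assms(1), of \<theta> 0] by (auto simp: u_def a_def)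
  define P where "P t = (x * sin t - y * cos t)\<^sup>2 * (t - a) + (x * cos t + y * sin t) * (x * sin t - y * cos t)" for t
  have P: "\<bar>P \<theta> - P u - s * (\<theta> - u)\<bar> \<le> 16 * R\<^sup>2 * (1 / n) * (\<theta> - u)"
    unfolding P_def s_def by (rule rotation_variation) (use assms au u ta in auto)
  have sh: "\<bar>kakeya_shift n S \<theta> - kakeya_shift n S u + k * S / n * (\<theta> - u)\<bar> \<le> S / real n ^ (k + 2)"
    unfolding u_def using assms k S by (intro kakeya_shift_variation) auto
  have "\<bar>(s - k * S / n) * (\<theta> - u)\<bar> \<le> S / n * (1 / real n ^ (k + 1))"
    unfolding abs_mult using ks u by (intro mult_mono) auto
  also have "\<dots> = S / real n ^ (k + 2)" by simp
  finally have sk: "\<bar>(s - k * S / n) * (\<theta> - u)\<bar> \<le> S / real n ^ (k + 2)" .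
  have "16 * R\<^sup>2 * (1 / n) * (\<theta> - u) \<le> 16 * R\<^sup>2 * (1 / n) * (1 / real n ^ (k + 1))"
    using u by (intro mult_left_mono) auto
  also have "\<dots> = 16 * R\<^sup>2 / real n ^ (k + 2)" by simp
  finally have P': "\<bar>P \<theta> - P u - s * (\<theta> - u)\<bar> \<le> 16 * R\<^sup>2 / real n ^ (k + 2)"
    using P by linarith
  have e: "fibre_height n S x y t = P t + kakeya_shift n S t" if "grid_floor n 0 t = a" for t
    using that by (simp add: fibre_height_def sl2_height_def P_def)
  have d: "fibre_height n S x y \<theta> - fibre_height n S x y u =
     (P \<theta> - P u - s * (\<theta> - u)) + (kakeya_shift n S \<theta> - kakeya_shift n S u + k * S / n * (\<theta> - u))
       + (s - k * S / n) * (\<theta> - u)"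
    using e[of \<theta>] e[of u] a' by (simp add: a_def algebra_simps)
  have "\<bar>fibre_height n S x y \<theta> - fibre_height n S x y u\<bar>
      \<le> 16 * R\<^sup>2 / real n ^ (k + 2) + S / real n ^ (k + 2) + S / real n ^ (k + 2)"
    unfolding d by (intro abs_triangle_ineq[THEN order_trans] add_mono P' sh sk)
  also have "\<dots> = 24 * R\<^sup>2 / real n ^ (k + 2)"
    unfolding add_divide_distrib[symmetric] S_def by simp
  finally show "\<bar>fibre_height n S x y \<theta> - fibre_height n S x y (grid_floor n k \<theta>)\<bar> \<le> 24 * R\<^sup>2 / real n ^ (k + 2)"
    unfolding u_def .
qed

text \<open>Cells of level \<open>k\<close> are indexed by their base cell \<open>j\<close> and the
  position \<open>i\<close> inside it, so that the level may depend on \<open>j\<close>. The bound 7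
  admits a full turn, as \<open>2 * pi < 7\<close>.\<close>

lemma grid_floor_digits:
  assumes "n \<ge> 1" "0 \<le> \<theta>" "\<theta> < 7"
  obtains i j where "j < 7 * n" "i < n ^ k" "grid_floor n 0 \<theta> = real j / n"
    "grid_floor n k \<theta> = real (j * n ^ k + i) / real n ^ (k + 1)"
proof -
  define m where "m = nat \<lfloor>\<theta> * real n ^ (k + 1)\<rfloor>"
  define j where "j = nat \<lfloor>\<theta> * real n\<rfloor>"
  have n: "real n > 0" using assms by simp
  have m: "real m = \<lfloor>\<theta> * real n ^ (k + 1)\<rfloor>" and j: "real j = \<lfloor>\<theta> * real n\<rfloor>"
    using assms by (auto simp: m_def j_def)
  have "real j \<le> \<theta> * n" "\<theta> * n < real j + 1"
    unfolding j by linarith+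
  then have jj: "real j * real n ^ k \<le> \<theta> * real n ^ (k + 1)"
    "\<theta> * real n ^ (k + 1) < (real j + 1) * real n ^ k"
    using mult_right_mono[of "real j" "\<theta> * n" "real n ^ k"]
      mult_strict_right_mono[of "\<theta> * n" "real j + 1" "real n ^ k"] n by (auto simp: mult.assoc)
  have mm: "real m \<le> \<theta> * real n ^ (k + 1)" "\<theta> * real n ^ (k + 1) < real m + 1"
    unfolding m by linarith+
  have "real (j * n ^ k) < real (m + 1)" "real m < real ((j + 1) * n ^ k)"
    using jj mm by (simp_all add: algebra_simps)
  then have mj: "j * n ^ k \<le> m" "m < (j + 1) * n ^ k"
    unfolding of_nat_less_iff by simp_all
  have "\<theta> * n < 7 * n" using assms n by simp
  then have "real j < real (7 * n)" using \<open>real j \<le> \<theta> * n\<close> by simp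
  then have "j < 7 * n" unfolding of_nat_less_iff .
  moreover have "m - j * n ^ k < n ^ k" using mj by simp
  moreover have "grid_floor n 0 \<theta> = real j / n" by (simp add: grid_floor_def j)
  moreover have "grid_floor n k \<theta> = real (j * n ^ k + (m - j * n ^ k)) / real n ^ (k + 1)"
    using mj(1) by (simp add: grid_floor_def m)
  ultimately show ?thesis by (rule that)
qed

text \<open>Horizontally, a point of the tube is within \<open>d\<close> of the axis and within
  \<open>d\<close> of the corner \<open>(x, y)\<close> of its grid square, hence
  \<open>2 * d\<close>. The slope and parameter read off at the corner differ from the true ones by
  at most \<open>4 * d\<close>, so the height error is at most
  \<open>d + 8 R d + (4 d + 4 R d)\<close>, which is below \<open>17 R d\<close> as
  \<open>R \<ge> 1\<close>.\<close>

lemma fibre_height_near: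
  fixes h l x y t \<theta> d M R S :: real
  assumes "\<bar>h\<bar> \<le> M" "\<bar>l\<bar> \<le> 1 / 2" "n \<ge> 1" "0 \<le> d" "d \<le> 1" "M + 5 \<le> R"
    and x: "\<bar>x - (h * sin \<theta> + l * cos \<theta>)\<bar> \<le> 2 * d"
    and y: "\<bar>y - (l * sin \<theta> - h * cos \<theta>)\<bar> \<le> 2 * d"
    and t: "\<bar>t - (sl2_height n S \<theta> h + l * h)\<bar> \<le> d"
  shows "\<bar>t - fibre_height n S x y \<theta>\<bar> \<le> 17 * R * d"
proof -
  define u where "u = x - (h * sin \<theta> + l * cos \<theta>)"
  define w where "w = y - (l * sin \<theta> - h * cos \<theta>)"
  define l' where "l' = x * cos \<theta> + y * sin \<theta>"
  define h' where "h' = x * sin \<theta> - y * cos \<theta>"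
  define \<sigma> where "\<sigma> = \<theta> - grid_floor n 0 \<theta>"
  have xy: "x = u + h * sin \<theta> + l * cos \<theta>" "y = w + l * sin \<theta> - h * cos \<theta>"
    by (auto simp: u_def w_def)
  have sc: "a * (cos \<theta> * cos \<theta>) + a * (sin \<theta> * sin \<theta>) = a" for a
    unfolding distrib_left[symmetric] sin_cos_squared_add3 by simp
  have l': "l' - l = u * cos \<theta> + w * sin \<theta>" and h': "h' - h = u * sin \<theta> - w * cos \<theta>"
    unfolding l'_def h'_def xy using sc[of l] sc[of h] by (simp_all add: algebra_simps)
  have "\<bar>u * c\<bar> \<le> 2 * d * 1" "\<bar>w * c\<bar> \<le> 2 * d * 1" if "\<bar>c\<bar> \<le> 1" for c
    unfolding abs_mult using that x[folded u_def] y[folded w_def] assms(4)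
    by (intro mult_mono; simp)+
  note uw = this[OF abs_sin_le_one[of \<theta>]] this[OF abs_cos_le_one[of \<theta>]]
  have dl: "\<bar>l' - l\<bar> \<le> 4 * d" and dh: "\<bar>h' - h\<bar> \<le> 4 * d"
    unfolding l' h' using uw by linarith+
  have hR: "\<bar>h'\<bar> \<le> R" "\<bar>h' + h\<bar> \<le> 2 * R" using dh assms(1,5,6) by linarith+
  have "0 \<le> \<sigma>" "\<sigma> \<le> 1 / n"
    using grid_floor_le[OF assms(3), of 0 \<theta>] le_grid_floor[OF assms(3), of \<theta> 0] by (auto simp: \<sigma>_def)
  moreover have "1 / real n \<le> 1" using assms(3) by simp
  ultimately have \<sigma>: "\<bar>\<sigma>\<bar> \<le> 1" by linarith
  have "\<bar>h' + h\<bar> * \<bar>h' - h\<bar> * \<bar>\<sigma>\<bar> \<le> (2 * R) * (4 * d) * 1"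
    using hR dh \<sigma> assms(4)
    by (intro mult_mono mult_nonneg_nonneg; linarith)
  then have 1: "\<bar>(h'\<^sup>2 - h\<^sup>2) * \<sigma>\<bar> \<le> 8 * R * d"
    by (simp add: abs_mult[symmetric] power2_eq_square algebra_simps)
  have "\<bar>l\<bar> * \<bar>h' - h\<bar> \<le> 1 * (4 * d)" "\<bar>h'\<bar> * \<bar>l' - l\<bar> \<le> R * (4 * d)"
    using hR dh dl assms(2,4) by (intro mult_mono; linarith)+
  then have "\<bar>l * (h' - h)\<bar> \<le> 4 * d" "\<bar>h' * (l' - l)\<bar> \<le> 4 * R * d"
    by (simp_all add: abs_mult)
  moreover have "l' * h' - l * h = l * (h' - h) + h' * (l' - l)" by (simp add: algebra_simps)
  ultimately have 2: "\<bar>l' * h' - l * h\<bar> \<le> 4 * d + 4 * R * d" by linarith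
  have "fibre_height n S x y \<theta> - (sl2_height n S \<theta> h + l * h) = (h'\<^sup>2 - h\<^sup>2) * \<sigma> + (l' * h' - l * h)"
    by (simp add: fibre_height_def sl2_height_def l'_def h'_def \<sigma>_def algebra_simps)
  then have "\<bar>t - fibre_height n S x y \<theta>\<bar> \<le> d + 8 * R * d + (4 * d + 4 * R * d)"
    using 1 2 t by linarith
  also have "\<dots> = (5 + 12 * R) * d" by (simp add: algebra_simps)
  also have "\<dots> \<le> 17 * R * d" using assms(1,4,6) by (intro mult_right_mono; linarith)
  finally show ?thesis .
qed

lemma emeasure_UN_le_card:
  fixes c :: real
  assumes "finite I" "\<And>i. i \<in> I \<Longrightarrow> A i \<in> sets M" "\<And>i. i \<in> I \<Longrightarrow> emeasure M (A i) \<le> ennreal c"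
    and "c \<ge> 0"
  shows "emeasure M (\<Union>i\<in>I. A i) \<le> ennreal (card I * c)"
proof -
  have "emeasure M (\<Union>i\<in>I. A i) \<le> (\<Sum>i\<in>I. emeasure M (A i))"
    using assms by (intro emeasure_subadditive_finite) auto
  also have "\<dots> \<le> (\<Sum>i\<in>I. ennreal c)" using assms by (intro sum_mono) auto
  also have "\<dots> = ennreal (card I * c)" using assms by (simp add: ennreal_mult ennreal_of_nat_eq_real_of_nat)
  finally show ?thesis .
qed

text \<open>The midpoint is the point \<open>l = 0\<close> of the line with angle \<theta> and slope
  \<open>h\<close>; the factor makes the direction a unit vector, as the encoding of tubes
  requires.\<close>

definition sl2_kakeya_tube :: "real \<Rightarrow> real \<Rightarrow> real \<Rightarrow> tube" where
  "sl2_kakeya_tube \<theta> h t =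
     (vector [h * sin \<theta>, - (h * cos \<theta>), t], (1 / sqrt (1 + h\<^sup>2)) *\<^sub>R vector [cos \<theta>, sin \<theta>, h])"

lemma tube_setE:
  assumes "q \<in> tube_set d (sl2_kakeya_tube \<theta> h t)"
  obtains l where "\<bar>l\<bar> \<le> 1 / 2" "\<bar>q $ 1 - (h * sin \<theta> + l * cos \<theta>)\<bar> \<le> d"
    "\<bar>q $ 2 - (l * sin \<theta> - h * cos \<theta>)\<bar> \<le> d" "\<bar>q $ 3 - (t + l * h)\<bar> \<le> d"
proof -
  obtain s v where s: "\<bar>s\<bar> \<le> 1 / 2" "norm v \<le> d"
    and q: "q = fst (sl2_kakeya_tube \<theta> h t) + s *\<^sub>R dir (sl2_kakeya_tube \<theta> h t) + v"
    using assms by (auto simp: tube_set_def)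
  have v: "\<bar>v $ i\<bar> \<le> d" for i
    using component_le_norm_cart[of v i] s by linarith
  have 1: "1 \<le> sqrt (1 + h\<^sup>2)" by simp
  define l where "l = s / sqrt (1 + h\<^sup>2)"
  have "q $ 1 = h * sin \<theta> + l * cos \<theta> + v $ 1" "q $ 2 = l * sin \<theta> - h * cos \<theta> + v $ 2"
    "q $ 3 = t + l * h + v $ 3"
    by (simp_all add: q sl2_kakeya_tube_def dir_def l_def)
  moreover have "\<bar>l\<bar> \<le> 1 / 2"
    unfolding l_def abs_divide using s 1 frac_le[of "1/2" "\<bar>s\<bar>" 1 "sqrt (1 + h\<^sup>2)"] by simp
  ultimately show ?thesis
    using v[of 1] v[of 2] v[of 3] by (intro that[of l]) simp_all
qed

lemma emeasure_lborel_box3: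
  fixes x y z x' y' z' :: real
  assumes "x \<le> x'" "y \<le> y'" "z \<le> z'"
  shows "emeasure lborel (cbox (vector [x, y, z] :: real ^ 3) (vector [x', y', z']))
    = ennreal ((x' - x) * (y' - y) * (z' - z))"
proof -
  let ?C = "cbox (vector [x, y, z] :: real ^ 3) (vector [x', y', z'])"
  have "vector [x, y, z] \<in> ?C" using assms by (simp add: mem_box_cart forall_3)
  then have ne: "?C \<noteq> {}" by blast
  have "measure lborel ?C = (x' - x) * (y' - y) * (z' - z)"
    unfolding content_cbox_cart[OF ne] UNIV_3 by simp
  moreover have "emeasure lborel ?C = ennreal (measure lborel ?C)"
    using emeasure_lborel_cbox_finite[of "vector [x, y, z]" "vector [x', y', z']"]
    by (intro emeasure_eq_ennreal_measure) (simp add: less_top)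
  ultimately show ?thesis by simp
qed

text \<open>The base square \<open>[- R, R]^2\<close> is cut into squares of side \<open>d\<close>.
  Over each of them a base cell \<open>j\<close> of level \<open>k\<close> needs
  \<open>n ^ k\<close> boxes of height \<open>82 R^2 / n ^ (k + 2)\<close>, in total
  \<open>82 R^2 / n^2\<close> whatever \<open>k\<close> is. With \<open>7 n\<close> base cells and
  base area \<open>4 R^2\<close> the volume is \<open>2296 R^4 / n\<close>.\<close>

lemma compression_cover:
  fixes n R :: nat and M :: real
  assumes n: "n \<ge> 1" and M: "M \<ge> 0" "M + 5 \<le> R"
  defines "S \<equiv> 4 * (real R)\<^sup>2" and "d \<equiv> 1 / real n ^ (n + 2)"
  obtains E where "E \<in> sets borel" "emeasure lborel E \<le> ennreal (2296 * real R ^ 4 / n)"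
    "\<And>\<theta> h. 0 \<le> \<theta> \<Longrightarrow> \<theta> < 7 \<Longrightarrow> \<bar>h\<bar> \<le> M \<Longrightarrow>
       tube_set d (sl2_kakeya_tube \<theta> h (sl2_height n S \<theta> h)) \<subseteq> E"
proof -
  define N where "N = n ^ (n + 2)"
  have N1: "N \<ge> 1" unfolding N_def using n by (rule one_le_power)
  have dN: "d = 1 / N" by (simp add: N_def d_def)
  have N: "N \<ge> 1" "d * N = 1" and d: "0 < d" "d \<le> 1"
    using N1 by (auto simp: dN)
  \<comment> \<open>The integers \<open>a\<close>, \<open>b\<close> index a square by its lower left
    corner. The level is evaluated at that corner, so it may change with the square and with the
    base cell.\<close>
  define k where "k a b j = fibre_level n S (of_int a * d) (of_int b * d) (real j / n)" for a b :: int and j :: nat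
  define c where "c a b j i = fibre_height n S (of_int a * d) (of_int b * d)
     (real (j * n ^ k a b j + i) / real n ^ (k a b j + 1))" for a b :: int and j i :: nat
  \<comment> \<open>41 = 24 + 17: the variation over one cell of angles, and the error from the
    thickness of the tube together with the passage to the corner.\<close>
  define r where "r a b j = 41 * (real R)\<^sup>2 / real n ^ (k a b j + 2)" for a b :: int and j :: nat
  define Q :: "int \<Rightarrow> int \<Rightarrow> nat \<Rightarrow> nat \<Rightarrow> (real ^ 3) set" where
    "Q a b j i = cbox (vector [of_int a * d, of_int b * d, c a b j i - r a b j])
       (vector [(of_int a + 1) * d, (of_int b + 1) * d, c a b j i + r a b j])" for a b j i
  define I where "I = {- int (R * N)..<int (R * N)}"
  define E where "E = (\<Union>a\<in>I. \<Union>b\<in>I. \<Union>j\<in>{..<7 * n}. \<Union>i\<in>{..<n ^ k a b j}. Q a b j i)"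
  have I: "finite I" "real (card I) = 2 * R * N" by (auto simp: I_def)
  have Qs: "Q a b j i \<in> sets borel" for a b j i by (simp add: Q_def)
  have r0: "r a b j \<ge> 0" for a b j by (simp add: r_def)
  have Qe: "emeasure lborel (Q a b j i) \<le> ennreal (2 * d\<^sup>2 * r a b j)" for a b j i
    unfolding Q_def using d(1) r0[of a b j]
    by (subst emeasure_lborel_box3) (auto simp: distrib_right power2_eq_square)
  \<comment> \<open>Volume over one square and one base cell: the number \<open>n ^ k\<close> of
    boxes cancels the level in \<open>r\<close>, so all levels obey the same bound.\<close>
  define V where "V = 82 * (real R)\<^sup>2 * d\<^sup>2 / (real n)\<^sup>2"
  have V: "V \<ge> 0" by (simp add: V_def)
  define E1 where "E1 a b j = (\<Union>i\<in>{..<n ^ k a b j}. Q a b j i)" for a b j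
  define E2 where "E2 a b = (\<Union>j\<in>{..<7 * n}. E1 a b j)" for a b
  define E3 where "E3 a = (\<Union>b\<in>I. E2 a b)" for a
  have E1s: "E1 a b j \<in> sets borel" for a b j
    unfolding E1_def by (intro sets.finite_UN finite_lessThan Qs)
  have E2s: "E2 a b \<in> sets borel" for a b
    unfolding E2_def by (intro sets.finite_UN finite_lessThan E1s)
  have E3s: "E3 a \<in> sets borel" for a
    unfolding E3_def by (intro sets.finite_UN I(1) E2s)
  have E: "E = (\<Union>a\<in>I. E3 a)" by (simp only: E_def E1_def E2_def E3_def)
  have Es: "E \<in> sets borel"
    unfolding E by (intro sets.finite_UN I(1) E3s)
  have E1e: "emeasure lborel (E1 a b j) \<le> ennreal V" for a b j
  proof -
    have "emeasure lborel (E1 a b j) \<le> ennreal (card {..<n ^ k a b j} * (2 * d\<^sup>2 * r a b j))"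
      unfolding E1_def using Qs Qe r0[of a b j] by (intro emeasure_UN_le_card) simp_all
    moreover have "card {..<n ^ k a b j} * (2 * d\<^sup>2 * r a b j) = V"
      using n(1) unfolding r_def V_def by (simp add: power_add power2_eq_square)
    ultimately show ?thesis by (simp only:)
  qed
  have E2e: "emeasure lborel (E2 a b) \<le> ennreal (card {..<7 * n} * V)" for a b
    unfolding E2_def by (rule emeasure_UN_le_card[OF _ _ E1e V]) (simp_all add: E1s)
  have E3e: "emeasure lborel (E3 a) \<le> ennreal (card I * (card {..<7 * n} * V))" for a
    unfolding E3_def by (rule emeasure_UN_le_card[OF I(1) _ E2e]) (simp_all add: E2s V)
  have Ec: "emeasure lborel E \<le> ennreal (card I * (card I * (card {..<7 * n} * V)))"
    unfolding E by (rule emeasure_UN_le_card[OF I(1) _ E3e]) (simp_all add: E3s V)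
  have "card I * (card I * (card {..<7 * n} * V))
     = 2296 * real R ^ 4 / n * (d * N)\<^sup>2"
  proof -
    have "2 * r * m * (2 * r * m * (7 * t * (82 * r\<^sup>2 * e\<^sup>2 / t\<^sup>2))) = 2296 * r ^ 4 / t * (e * m)\<^sup>2"
      if "t \<noteq> 0" for r m t e :: real
      using that by (simp add: power2_eq_square power4_eq_xxxx)
    from this[of n R N d] show ?thesis unfolding I(2) V_def using n by simp
  qed
  then have Ee: "emeasure lborel E \<le> ennreal (2296 * real R ^ 4 / n)"
    using Ec by (simp only: N(2) power_one mult_1_right)
  show ?thesis
  proof (rule that[OF Es Ee], rule subsetI)
    fix \<theta> h q assume th: "0 \<le> \<theta>" "\<theta> < 7" and h: "\<bar>h\<bar> \<le> M"
      and "q \<in> tube_set d (sl2_kakeya_tube \<theta> h (sl2_height n S \<theta> h))"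
    then obtain l where l: "\<bar>l\<bar> \<le> 1 / 2" "\<bar>q $ 1 - (h * sin \<theta> + l * cos \<theta>)\<bar> \<le> d"
      "\<bar>q $ 2 - (l * sin \<theta> - h * cos \<theta>)\<bar> \<le> d" "\<bar>q $ 3 - (sl2_height n S \<theta> h + l * h)\<bar> \<le> d"
      by (elim tube_setE)
    define a where "a = \<lfloor>q $ 1 * N\<rfloor>"
    define b where "b = \<lfloor>q $ 2 * N\<rfloor>"
    have cell: "of_int \<lfloor>z * N\<rfloor> * d \<le> z \<and> z \<le> (of_int \<lfloor>z * N\<rfloor> + 1) * d \<and> \<bar>z - of_int \<lfloor>z * N\<rfloor> * d\<bar> \<le> d" for z :: real
    proof -
      have "of_int \<lfloor>z * N\<rfloor> \<le> z * N" "z * N \<le> of_int \<lfloor>z * N\<rfloor> + 1" by linarith+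
      then have "of_int \<lfloor>z * N\<rfloor> * d \<le> z * N * d" "z * N * d \<le> (of_int \<lfloor>z * N\<rfloor> + 1) * d"
        using d(1) by (intro mult_right_mono; simp)+
      moreover have "z * N * d = z" using N(2) by (simp add: mult.commute mult.left_commute)
      ultimately show ?thesis unfolding distrib_right by linarith
    qed
    \<comment> \<open>The margin 2 absorbs \<open>\<bar>l\<bar> \<le> 1 / 2\<close> and the radius
      \<open>d \<le> 1\<close>; as \<open>R \<ge> M + 5\<close>, the corner of the square also stays
      within \<open>R\<close>.\<close>
    have inI: "\<lfloor>z * N\<rfloor> \<in> I \<and> \<bar>of_int \<lfloor>z * N\<rfloor> * d\<bar> \<le> R" if "\<bar>z\<bar> \<le> M + 2" for z :: real
    proof -
      have "- real R \<le> z" "z < R" using that M by linarith+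
      then have "- real R * N \<le> z * N" "z * N < real R * N"
        using N(1) mult_right_mono[of "- real R" z "real N"] by simp_all
      then have "\<lfloor>z * N\<rfloor> \<in> I" by (auto simp: I_def le_floor_iff floor_less_iff)
      moreover have "\<bar>of_int \<lfloor>z * N\<rfloor> * d\<bar> \<le> R"
        using cell[of z] that M(2) d(2) by linarith
      ultimately show ?thesis ..
    qed
    have tr: "\<bar>h * s\<bar> \<le> M \<and> \<bar>l * s\<bar> \<le> 1 / 2" if "\<bar>s\<bar> \<le> 1" for s
      unfolding abs_mult
      using that h l(1) mult_mono[of "\<bar>h\<bar>" M "\<bar>s\<bar>" 1] mult_mono[of "\<bar>l\<bar>" "1/2" "\<bar>s\<bar>" 1] M(1)
      by simp
    have "\<bar>q $ 1\<bar> \<le> M + 2"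
      using l(2) tr[OF abs_sin_le_one[of \<theta>]] tr[OF abs_cos_le_one[of \<theta>]] d by linarith
    note a = inI[OF this, folded a_def]
    have "\<bar>q $ 2\<bar> \<le> M + 2"
      using l(3) tr[OF abs_sin_le_one[of \<theta>]] tr[OF abs_cos_le_one[of \<theta>]] d by linarith
    note b = inI[OF this, folded b_def]
    note ca = cell[of "q $ 1", folded a_def] and cb = cell[of "q $ 2", folded b_def]
    let ?x = "of_int a * d" and ?y = "of_int b * d"
    define K where "K = fibre_level n S ?x ?y (grid_floor n 0 \<theta>)"
    obtain i j where ij: "j < 7 * n" "i < n ^ K" "grid_floor n 0 \<theta> = real j / n"
      "grid_floor n K \<theta> = real (j * n ^ K + i) / real n ^ (K + 1)"
      using grid_floor_digits[OF n th] by blast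
    have K: "k a b j = K" by (simp add: k_def K_def ij)
    have cij: "c a b j i = fibre_height n S ?x ?y (grid_floor n K \<theta>)"
      unfolding c_def K ij ..
    have R: "real R > 0" using M by linarith
    have "K \<le> n" and v: "\<bar>fibre_height n S ?x ?y \<theta> - c a b j i\<bar> \<le> 24 * (real R)\<^sup>2 / real n ^ (K + 2)"
      using fibre_height_variation[OF n R, of ?x ?y \<theta>] a b unfolding cij K_def S_def by auto
    \<comment> \<open>The exponent \<open>n + 2\<close> in \<open>d\<close> is matched to the finest
      level \<open>n\<close>, so the thickness never exceeds the scale of the boxes.\<close>
    have "d \<le> 1 / real n ^ (K + 2)"
      unfolding d_def using n \<open>K \<le> n\<close> by (intro divide_left_mono power_increasing) auto
    moreover have "real R \<le> (real R)\<^sup>2" using M by (intro self_le_power) auto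
    ultimately have "real R * d \<le> (real R)\<^sup>2 * (1 / real n ^ (K + 2))"
      using d(1) by (intro mult_mono; simp)
    then have rd: "17 * real R * d \<le> 17 * (real R)\<^sup>2 / real n ^ (K + 2)" by simp
    have "\<bar>q $ 3 - fibre_height n S ?x ?y \<theta>\<bar> \<le> 17 * real R * d"
    proof (rule fibre_height_near[OF h l(1) n _ d(2) M(2)])
      show "\<bar>?x - (h * sin \<theta> + l * cos \<theta>)\<bar> \<le> 2 * d" using l(2) ca by linarith
      show "\<bar>?y - (l * sin \<theta> - h * cos \<theta>)\<bar> \<le> 2 * d" using l(3) cb by linarith
    qed (use d(1) l(4) in simp_all)
    then have "\<bar>q $ 3 - c a b j i\<bar> \<le> 17 * (real R)\<^sup>2 / real n ^ (K + 2) + 24 * (real R)\<^sup>2 / real n ^ (K + 2)"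
      using v rd by linarith
    also have "\<dots> = r a b j" unfolding r_def K add_divide_distrib[symmetric] by simp
    finally have "\<bar>q $ 3 - c a b j i\<bar> \<le> r a b j" .
    then have "q \<in> Q a b j i"
      using ca cb unfolding Q_def mem_box_cart forall_3 vector_3 by linarith
    then show "q \<in> E"
      unfolding E_def using a b ij(1,2) unfolding K[symmetric] by blast
  qed
qed

section \<open>Compressed \<open>SL_2\<close> tubes in prescribed directions\<close>

lemma line_reparam:
  assumes "\<kappa> \<noteq> 0"
  shows "line (m + \<mu> *\<^sub>R v) (\<kappa> *\<^sub>R v) = line m v"
proof -
  have "m + \<mu> *\<^sub>R v + t *\<^sub>R \<kappa> *\<^sub>R v = m + (\<mu> + t * \<kappa>) *\<^sub>R v" for t
    by (simp add: algebra_simps)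
  moreover have "m + t *\<^sub>R v = m + \<mu> *\<^sub>R v + ((t - \<mu>) / \<kappa>) *\<^sub>R \<kappa> *\<^sub>R v" for t
    using assms by (simp add: scaleR_left_distrib[symmetric])
  ultimately show ?thesis unfolding line_def by blast
qed

lemma norm_vector_3: "norm (vector [x, y, z] :: real ^ 3) = sqrt (x\<^sup>2 + y\<^sup>2 + z\<^sup>2)"
  by (simp add: norm_eq_sqrt_inner inner_vec_def sum_3 power2_eq_square)

lemma vec3_eq_iff: "(v :: real ^ 3) = w \<longleftrightarrow> v $ 1 = w $ 1 \<and> v $ 2 = w $ 2 \<and> v $ 3 = w $ 3"
  by (simp add: vec_eq_iff forall_3)

text \<open>For \<open>h = 0\<close> the line is horizontal and meets the vertical axis, which is
  the second kind of \<open>SL_2\<close> line. Otherwise it is slid to height 0 and its direction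
  scaled to third component 1; the determinant becomes \<open>sin^2 + cos^2\<close>.\<close>

lemma sl2_tube_kakeya_tube: "sl2_tube (sl2_kakeya_tube \<theta> h t)"
proof -
  define q where "q = sqrt (1 + h\<^sup>2)"
  have q: "q > 0" unfolding q_def by (intro real_sqrt_gt_zero add_pos_nonneg) auto
  have "norm (dir (sl2_kakeya_tube \<theta> h t)) = 1 / q * sqrt ((cos \<theta>)\<^sup>2 + (sin \<theta>)\<^sup>2 + h\<^sup>2)"
    using q by (simp add: dir_def sl2_kakeya_tube_def norm_vector_3 flip: q_def)
  also have "\<dots> = 1" using q unfolding sin_cos_squared_add2 q_def[symmetric] by simp
  finally have n: "norm (dir (sl2_kakeya_tube \<theta> h t)) = 1" .
  have "sl2_line (centre_line (sl2_kakeya_tube \<theta> h t))"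
  proof (cases "h = 0")
    case True
    have nz: "(cos \<theta>, sin \<theta>) \<noteq> (0, 0)"
      using sin_zero_norm_cos_one[of \<theta>] by auto
    have "centre_line (sl2_kakeya_tube \<theta> h t) = line (vector [0, 0, t]) (vector [cos \<theta>, sin \<theta>, 0])"
      by (simp add: centre_line_def sl2_kakeya_tube_def True)
    then show ?thesis unfolding sl2_line_def using nz by blast
  next
    case False
    define a where "a = h * sin \<theta> - t * cos \<theta> / h"
    define b where "b = - (h * cos \<theta>) - t * sin \<theta> / h"
    have "a * (sin \<theta> / h) - b * (cos \<theta> / h) = (sin \<theta>)\<^sup>2 + (cos \<theta>)\<^sup>2"
      using False by (simp add: a_def b_def field_simps power2_eq_square del: sin_cos_squared_add sin_cos_squared_add2 sin_cos_squared_add3)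
    then have 1: "a * (sin \<theta> / h) - b * (cos \<theta> / h) = 1" by simp
    have "centre_line (sl2_kakeya_tube \<theta> h t)
        = line (vector [a, b, 0] + t *\<^sub>R vector [cos \<theta> / h, sin \<theta> / h, 1])
            ((h / q) *\<^sub>R vector [cos \<theta> / h, sin \<theta> / h, 1])"
      unfolding centre_line_def
      by (rule arg_cong2[where f = line]) (use False in \<open>simp_all add: sl2_kakeya_tube_def vec3_eq_iff a_def b_def flip: q_def\<close>)
    also have "\<dots> = line (vector [a, b, 0]) (vector [cos \<theta> / h, sin \<theta> / h, 1])"
      using False q by (intro line_reparam) simp
    finally show ?thesis unfolding sl2_line_def using 1 by blast
  qed
  with n show ?thesis by (simp add: sl2_tube_def)
qed

text \<open>A non-vertical unit vector determines the slope as the ratio of its vertical component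
  to its horizontal length, and \<theta> is the polar angle of its horizontal part.\<close>

lemma sl2_kakeya_tube_direction:
  fixes e :: "real ^ 3"
  assumes "norm e = 1" "(e $ 1)\<^sup>2 + (e $ 2)\<^sup>2 > 0"
  obtains \<theta> where "0 \<le> \<theta>" "\<theta> < 7"
    "\<And>t. dir (sl2_kakeya_tube \<theta> (e $ 3 / sqrt ((e $ 1)\<^sup>2 + (e $ 2)\<^sup>2)) t) = e"
proof -
  define \<rho> where "\<rho> = sqrt ((e $ 1)\<^sup>2 + (e $ 2)\<^sup>2)"
  have \<rho>: "\<rho> > 0" "\<rho>\<^sup>2 = (e $ 1)\<^sup>2 + (e $ 2)\<^sup>2" using assms by (auto simp: \<rho>_def)
  have "norm e ^ 2 = (e $ 1)\<^sup>2 + (e $ 2)\<^sup>2 + (e $ 3)\<^sup>2"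
    unfolding power2_norm_eq_inner by (simp add: inner_vec_def sum_3 power2_eq_square)
  then have e: "\<rho>\<^sup>2 + (e $ 3)\<^sup>2 = 1" using assms \<rho> by simp
  have "(e $ 1 / \<rho>)\<^sup>2 + (e $ 2 / \<rho>)\<^sup>2 = ((e $ 1)\<^sup>2 + (e $ 2)\<^sup>2) / \<rho>\<^sup>2"
    by (simp add: power_divide add_divide_distrib)
  then have "(e $ 1 / \<rho>)\<^sup>2 + (e $ 2 / \<rho>)\<^sup>2 = 1" using \<rho>(1) unfolding \<rho>(2)[symmetric] by simp
  then obtain \<theta> where \<theta>: "0 \<le> \<theta>" "\<theta> < 2 * pi" "e $ 1 / \<rho> = cos \<theta>" "e $ 2 / \<rho> = sin \<theta>"
    using sincos_total_2pi by metis
  have "1 + (e $ 3 / \<rho>)\<^sup>2 = (\<rho>\<^sup>2 + (e $ 3)\<^sup>2) / \<rho>\<^sup>2"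
    using \<rho>(1) by (simp add: power_divide add_divide_distrib)
  then have "sqrt (1 + (e $ 3 / \<rho>)\<^sup>2) = 1 / \<rho>"
    unfolding e using \<rho>(1) by (simp add: real_sqrt_divide)
  then have "dir (sl2_kakeya_tube \<theta> (e $ 3 / \<rho>) t) = e" for t
    using \<rho>(1) by (simp add: sl2_kakeya_tube_def dir_def vec3_eq_iff flip: \<theta>(3,4))
  moreover have "\<theta> < 7" using \<theta>(2) pi_less_4 pi_approx by simp
  ultimately show ?thesis using \<theta>(1) unfolding \<rho>_def by (intro that)
qed

lemma norm_sl2_kakeya_tube: "norm (fst (sl2_kakeya_tube \<theta> h t)) \<le> \<bar>h\<bar> + \<bar>t\<bar>"
proof -
  have "(h * sin \<theta>)\<^sup>2 + (h * cos \<theta>)\<^sup>2 = h\<^sup>2"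
    unfolding power_mult_distrib distrib_left[symmetric] by simp
  then have "norm (fst (sl2_kakeya_tube \<theta> h t)) = sqrt (h\<^sup>2 + t\<^sup>2)"
    by (simp add: sl2_kakeya_tube_def norm_vector_3)
  also have "\<dots> \<le> \<bar>h\<bar> + \<bar>t\<bar>" by (rule sqrt_sum_squares_le_sum_abs)
  finally show ?thesis .
qed

lemma sl2_height_bound:
  assumes "n \<ge> 1" "S \<ge> 0"
  shows "\<bar>sl2_height n S \<theta> h\<bar> \<le> (h\<^sup>2 + S) / n"
proof -
  have "0 \<le> \<theta> - grid_floor n 0 \<theta>" "\<theta> - grid_floor n 0 \<theta> \<le> 1 / n"
    using grid_floor_le[OF assms(1), of 0 \<theta>] le_grid_floor[OF assms(1), of \<theta> 0] by simp_all
  then have "0 \<le> h\<^sup>2 * (\<theta> - grid_floor n 0 \<theta>)" "h\<^sup>2 * (\<theta> - grid_floor n 0 \<theta>) \<le> h\<^sup>2 * (1 / n)"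
    by (intro mult_nonneg_nonneg mult_left_mono; simp)+
  then show ?thesis
    unfolding sl2_height_def add_divide_distrib using kakeya_shift_bound[OF assms, of \<theta>] by simp
qed

text \<open>One radius and one small set serve all directions of slope at most \<open>M\<close>. The
  bound on the midpoint later keeps the tubes inside the unit ball.\<close>

lemma sl2_compression:
  fixes M \<epsilon> :: real
  assumes "\<epsilon> > 0" "M \<ge> 0"
  obtains d E where "d > 0" "E \<in> sets borel" "emeasure lborel E \<le> ennreal \<epsilon>"
    "\<And>e. norm e = 1 \<Longrightarrow> (e $ 1)\<^sup>2 + (e $ 2)\<^sup>2 > 0 \<Longrightarrow> \<bar>e $ 3 / sqrt ((e $ 1)\<^sup>2 + (e $ 2)\<^sup>2)\<bar> \<le> M \<Longrightarrow>
       \<exists>T. sl2_tube T \<and> dir T = e \<and> tube_set d T \<subseteq> E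
         \<and> norm (fst T) \<le> \<bar>e $ 3 / sqrt ((e $ 1)\<^sup>2 + (e $ 2)\<^sup>2)\<bar> + \<epsilon>"
proof -
  obtain R :: nat where R: "M + 5 \<le> R" using real_arch_simple by blast
  define S where "S = 4 * (real R)\<^sup>2"
  \<comment> \<open>\<open>B\<close> dominates the numerators of both the volume bound and the
    height bound, each of which decays like \<open>1 / n\<close>.\<close>
  define B where "B = 2296 * real R ^ 4 + M\<^sup>2 + S"
  obtain n0 :: nat where "B / \<epsilon> \<le> n0" using real_arch_simple by blast
  then have "B \<le> \<epsilon> * n0" using assms by (simp add: field_simps)
  also have "\<dots> \<le> \<epsilon> * (n0 + 1)" using assms by simp
  finally have B: "B \<le> \<epsilon> * (n0 + 1)" .
  define n where "n = n0 + 1"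
  have n: "n \<ge> 1" by (simp add: n_def)
  have "2296 * real R ^ 4 \<le> \<epsilon> * n" "M\<^sup>2 + S \<le> \<epsilon> * n"
    using B zero_le_power[of "real R" 4] zero_le_power2[of M] zero_le_power2[of "real R"]
    unfolding B_def S_def n_def of_nat_add of_nat_1 by linarith+
  then have Bn: "2296 * real R ^ 4 / n \<le> \<epsilon>" "(M\<^sup>2 + S) / n \<le> \<epsilon>"
    using n by (auto simp: divide_le_eq)
  obtain E where E: "E \<in> sets borel" "emeasure lborel E \<le> ennreal (2296 * real R ^ 4 / n)"
    "\<And>\<theta> h. 0 \<le> \<theta> \<Longrightarrow> \<theta> < 7 \<Longrightarrow> \<bar>h\<bar> \<le> M \<Longrightarrow>
       tube_set (1 / real n ^ (n + 2)) (sl2_kakeya_tube \<theta> h (sl2_height n S \<theta> h)) \<subseteq> E"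
    using compression_cover[OF n assms(2) R] unfolding S_def by metis
  show ?thesis
  proof (rule that[OF _ E(1)])
    show "1 / real n ^ (n + 2) > 0" using n by simp
    show "emeasure lborel E \<le> ennreal \<epsilon>"
      using E(2) Bn(1) ennreal_leI order_trans by blast
    fix e :: "real ^ 3"
    define h where "h = e $ 3 / sqrt ((e $ 1)\<^sup>2 + (e $ 2)\<^sup>2)"
    assume e: "norm e = 1" "(e $ 1)\<^sup>2 + (e $ 2)\<^sup>2 > 0"
      and "\<bar>e $ 3 / sqrt ((e $ 1)\<^sup>2 + (e $ 2)\<^sup>2)\<bar> \<le> M"
    then have h: "\<bar>h\<bar> \<le> M" by (simp only: h_def)
    obtain \<theta> where \<theta>: "0 \<le> \<theta>" "\<theta> < 7" "\<And>t. dir (sl2_kakeya_tube \<theta> h t) = e"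
      using sl2_kakeya_tube_direction[OF e] unfolding h_def by metis
    define T where "T = sl2_kakeya_tube \<theta> h (sl2_height n S \<theta> h)"
    have "\<bar>sl2_height n S \<theta> h\<bar> \<le> (h\<^sup>2 + S) / n"
      using n by (intro sl2_height_bound) (simp_all add: S_def)
    also have "\<dots> \<le> (M\<^sup>2 + S) / n"
      using h assms by (intro divide_right_mono add_right_mono) (simp_all add: abs_le_square_iff[symmetric])
    finally have "\<bar>sl2_height n S \<theta> h\<bar> \<le> \<epsilon>" using Bn by linarith
    then have "norm (fst T) \<le> \<bar>h\<bar> + \<epsilon>"
      using norm_sl2_kakeya_tube[of \<theta> h "sl2_height n S \<theta> h"] by (simp add: T_def)
    moreover have "tube_set (1 / real n ^ (n + 2)) T \<subseteq> E"
      unfolding T_def using \<theta>(1,2) h by (rule E(3))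
    moreover have "sl2_tube T" "dir T = e" unfolding T_def by (rule sl2_tube_kakeya_tube \<theta>(3))+
    ultimately show "\<exists>T. sl2_tube T \<and> dir T = e \<and> tube_set (1 / real n ^ (n + 2)) T \<subseteq> E
         \<and> norm (fst T) \<le> \<bar>e $ 3 / sqrt ((e $ 1)\<^sup>2 + (e $ 2)\<^sup>2)\<bar> + \<epsilon>"
      unfolding h_def[symmetric] by blast
  qed
qed

section \<open>Measure of tubes\<close>

text \<open>The explicit orthogonal decomposition replaces the existential description by closed
  conditions, from which measurability follows.\<close>

lemma tube_set_eq:
  assumes "norm (dir T) = 1"
  shows "tube_set \<delta> T = {x. \<bar>(x - fst T) \<bullet> dir T\<bar> \<le> 1 / 2 \<and>
     norm (x - fst T - ((x - fst T) \<bullet> dir T) *\<^sub>R dir T) \<le> \<delta>}"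
proof -
  have e: "dir T \<bullet> dir T = 1" using assms by (simp add: dot_square_norm)
  show ?thesis
  proof (intro set_eqI iffI)
    fix x assume "x \<in> tube_set \<delta> T"
    then obtain s v where x: "x = fst T + s *\<^sub>R dir T + v" "\<bar>s\<bar> \<le> 1 / 2" "v \<bullet> dir T = 0" "norm v \<le> \<delta>"
      by (auto simp: tube_set_def)
    have "(x - fst T) \<bullet> dir T = s" using x e by (simp add: inner_add_left)
    then show "x \<in> {x. \<bar>(x - fst T) \<bullet> dir T\<bar> \<le> 1 / 2 \<and>
        norm (x - fst T - ((x - fst T) \<bullet> dir T) *\<^sub>R dir T) \<le> \<delta>}"
      using x by simp
  next
    fix x assume x: "x \<in> {x. \<bar>(x - fst T) \<bullet> dir T\<bar> \<le> 1 / 2 \<and>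
        norm (x - fst T - ((x - fst T) \<bullet> dir T) *\<^sub>R dir T) \<le> \<delta>}"
    define s where "s = (x - fst T) \<bullet> dir T"
    define v where "v = x - fst T - s *\<^sub>R dir T"
    have "v \<bullet> dir T = 0" "x = fst T + s *\<^sub>R dir T + v"
      using e by (simp_all add: v_def s_def inner_diff_left)
    then show "x \<in> tube_set \<delta> T"
      using x unfolding tube_set_def mem_Collect_eq s_def[symmetric] v_def[symmetric] by blast
  qed
qed

lemma closed_tube_set:
  assumes "norm (dir T) = 1"
  shows "closed (tube_set \<delta> T)"
  unfolding tube_set_eq[OF assms] by (intro closed_Collect_conj closed_Collect_le continuous_intros)

lemma tube_set_mono: "\<delta> \<le> \<delta>' \<Longrightarrow> tube_set \<delta> T \<subseteq> tube_set \<delta>' T"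
  unfolding tube_set_def by force

lemma tube_set_subset_cball:
  assumes "norm (dir T) = 1"
  shows "tube_set \<delta> T \<subseteq> cball (fst T) (1 / 2 + \<delta>)"
proof
  fix x assume "x \<in> tube_set \<delta> T"
  then obtain s v where x: "x = fst T + s *\<^sub>R dir T + v" "\<bar>s\<bar> \<le> 1 / 2" "norm v \<le> \<delta>"
    by (auto simp: tube_set_def)
  have "norm (s *\<^sub>R dir T + v) \<le> \<bar>s\<bar> + norm v"
    using norm_triangle_ineq[of "s *\<^sub>R dir T" v] assms by simp
  moreover have "dist (fst T) x = norm (s *\<^sub>R dir T + v)"
    using x(1) by (metis dist_commute dist_norm add.assoc add_diff_cancel_left')
  ultimately show "x \<in> cball (fst T) (1 / 2 + \<delta>)" using x by simp
qed

lemma ball_subset_tube_set: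
  assumes "norm (dir T) = 1" "\<bar>s\<bar> + \<delta> \<le> 1 / 2"
  shows "ball (fst T + s *\<^sub>R dir T) \<delta> \<subseteq> tube_set \<delta> T"
proof
  fix x assume "x \<in> ball (fst T + s *\<^sub>R dir T) \<delta>"
  define w where "w = x - (fst T + s *\<^sub>R dir T)"
  have w: "norm w < \<delta>"
    using \<open>x \<in> _\<close> by (simp add: w_def dist_norm norm_minus_commute)
  have e: "dir T \<bullet> dir T = 1" using assms by (simp add: dot_square_norm)
  define v where "v = w - (w \<bullet> dir T) *\<^sub>R dir T"
  have v: "v \<bullet> dir T = 0" using e by (simp add: v_def inner_diff_left)
  have "v \<bullet> v = w \<bullet> w - (w \<bullet> dir T)\<^sup>2"
    using e by (simp add: v_def inner_diff_left inner_diff_right inner_commute power2_eq_square)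
  then have "(norm v)\<^sup>2 \<le> (norm w)\<^sup>2" by (simp add: power2_norm_eq_inner)
  then have "norm v \<le> norm w" by (rule power2_le_imp_le) simp
  moreover have "\<bar>w \<bullet> dir T\<bar> \<le> norm w"
    using Cauchy_Schwarz_ineq2[of w "dir T"] assms by simp
  ultimately have "\<bar>s + w \<bullet> dir T\<bar> \<le> 1 / 2" "norm v \<le> \<delta>"
    using w assms(2) by linarith+
  moreover have "x = fst T + (s + w \<bullet> dir T) *\<^sub>R dir T + v"
    by (simp add: v_def w_def algebra_simps)
  ultimately show "x \<in> tube_set \<delta> T"
    unfolding tube_set_def using v by blast
qed

text \<open>Disjoint balls of radius \<delta> are strung along one half of the axis at spacing
  \<open>2 * \<delta>\<close>. At least \<open>1 / (8 * \<delta>)\<close> of them fit, each of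
  volume \<open>unit_ball_vol 3 * \<delta> ^ 3\<close>.\<close>

lemma emeasure_tube_set_ge:
  assumes T: "norm (dir T) = 1" and \<delta>: "0 < \<delta>" "\<delta> \<le> 1 / 8"
  shows "ennreal (unit_ball_vol 3 / 8 * \<delta>\<^sup>2) \<le> emeasure lborel (tube_set \<delta> T)"
proof -
  define K where "K = nat \<lfloor>1 / (4 * \<delta>)\<rfloor>"
  have "real K = \<lfloor>1 / (4 * \<delta>)\<rfloor>" using \<delta> by (simp add: K_def)
  then have "K \<le> 1 / (4 * \<delta>)" "1 / (4 * \<delta>) < K + 1" by linarith+
  moreover have "1 \<le> 1 / (8 * \<delta>)" "1 / (4 * \<delta>) = 2 * (1 / (8 * \<delta>))" using \<delta> by (auto simp: field_simps)
  ultimately have "K \<le> 1 / (4 * \<delta>)" "1 / (8 * \<delta>) \<le> K" by linarith+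
  then have K: "K * \<delta> \<le> 1 / 4" "1 \<le> 8 * K * \<delta>" using \<delta> by (auto simp: field_simps)
  define A where "A i = ball (fst T + (2 * real i * \<delta>) *\<^sub>R dir T) \<delta>" for i :: nat
  have "disjoint_family_on A {..<K}"
    unfolding disjoint_family_on_def
  proof (intro ballI impI)
    fix i j :: nat assume "i \<noteq> j"
    have "dist (fst T + (2 * real i * \<delta>) *\<^sub>R dir T) (fst T + (2 * real j * \<delta>) *\<^sub>R dir T)
        = norm ((2 * \<delta> * (real i - real j)) *\<^sub>R dir T)"
      unfolding dist_norm by (rule arg_cong[where f = norm]) (simp add: algebra_simps)
    also have "\<dots> = 2 * \<delta> * \<bar>real i - real j\<bar>" using T \<delta> by (simp add: abs_mult)
    also have "\<dots> \<ge> 2 * \<delta> * 1" using \<open>i \<noteq> j\<close> \<delta> by (intro mult_left_mono) auto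
    finally show "A i \<inter> A j = {}" unfolding A_def by (intro disjoint_ballI) simp
  qed
  then have "emeasure lborel (\<Union>i<K. A i) = (\<Sum>i<K. emeasure lborel (A i))"
    by (intro sum_emeasure[symmetric]) (simp_all add: image_subset_iff, simp add: A_def)
  also have "\<dots> = ennreal (K * (unit_ball_vol 3 * \<delta> ^ 3))"
    using \<delta> by (simp add: A_def emeasure_ball ennreal_mult ennreal_of_nat_eq_real_of_nat)
  finally have e: "emeasure lborel (\<Union>i<K. A i) = ennreal (K * (unit_ball_vol 3 * \<delta> ^ 3))" .
  have "A i \<subseteq> tube_set \<delta> T" if "i < K" for i
  proof -
    have "(real i + 1) * \<delta> \<le> K * \<delta>" using that \<delta> by (intro mult_right_mono) auto
    then have "real i * \<delta> + \<delta> \<le> 1 / 4" using K by (simp add: algebra_simps)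
    then show ?thesis unfolding A_def using T \<delta> by (intro ball_subset_tube_set) auto
  qed
  then have "(\<Union>i<K. A i) \<subseteq> tube_set \<delta> T" by blast
  then have "emeasure lborel (\<Union>i<K. A i) \<le> emeasure lborel (tube_set \<delta> T)"
    using closed_tube_set[OF T] by (intro emeasure_mono) (auto simp: borel_closed)
  moreover have "ennreal (unit_ball_vol 3 / 8 * \<delta>\<^sup>2) \<le> ennreal (K * (unit_ball_vol 3 * \<delta> ^ 3))"
  proof (rule ennreal_leI)
    have "unit_ball_vol 3 / 8 * \<delta>\<^sup>2 * 1 \<le> unit_ball_vol 3 / 8 * \<delta>\<^sup>2 * (8 * K * \<delta>)"
      using K by (intro mult_left_mono) auto
    then show "unit_ball_vol 3 / 8 * \<delta>\<^sup>2 \<le> K * (unit_ball_vol 3 * \<delta> ^ 3)"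
      by (simp add: power2_eq_square power3_eq_cube algebra_simps)
  qed
  ultimately show ?thesis unfolding e by (rule order_trans[rotated])
qed

lemma emeasure_tube_set_pos_finite:
  assumes T: "norm (dir T) = 1" and \<delta>: "0 < \<delta>"
  shows "emeasure lborel (tube_set \<delta> T) \<noteq> 0" "emeasure lborel (tube_set \<delta> T) \<noteq> \<top>"
proof -
  \<comment> \<open>The lower bound is available only for radii up to \<open>1 / 8\<close>, so a
    thinner tube is placed inside.\<close>
  define m where "m = min \<delta> (1 / 8)"
  have m: "0 < m" "m \<le> 1 / 8" "m \<le> \<delta>" using \<delta> by (auto simp: m_def)
  have "0 < unit_ball_vol 3 / 8 * m\<^sup>2" using m(1) by (intro mult_pos_pos) simp_all
  then have "0 < ennreal (unit_ball_vol 3 / 8 * m\<^sup>2)" by simp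
  also have "\<dots> \<le> emeasure lborel (tube_set m T)"
    by (rule emeasure_tube_set_ge[OF T m(1,2)])
  also have "\<dots> \<le> emeasure lborel (tube_set \<delta> T)"
    by (rule emeasure_mono[OF tube_set_mono[OF m(3)]]) (simp add: borel_closed closed_tube_set[OF T])
  finally show "emeasure lborel (tube_set \<delta> T) \<noteq> 0" by simp
  have "bounded (tube_set \<delta> T)"
    by (rule bounded_subset[OF bounded_cball tube_set_subset_cball[OF T]])
  from emeasure_bounded_finite[OF this] show "emeasure lborel (tube_set \<delta> T) \<noteq> \<top>" by simp
qed

section \<open>Blow-up of the norms\<close>

lemma ennreal_powr_mono: "x \<le> y \<Longrightarrow> 0 \<le> a \<Longrightarrow> ennreal_powr x a \<le> ennreal_powr y a"
  by (auto simp: ennreal_powr_def top_unique intro!: ennreal_leI powr_mono2 enn2real_mono simp: less_top)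

lemma ennreal_powr_ennreal: "0 \<le> x \<Longrightarrow> ennreal_powr (ennreal x) a = ennreal (x powr a)"
  by (simp add: ennreal_powr_def)

lemma measurable_ennreal_powr [measurable]:
  assumes "f \<in> borel_measurable M"
  shows "(\<lambda>x. ennreal_powr (f x) a) \<in> borel_measurable M"
proof -
  have "{x :: ennreal. x = \<top>} \<in> sets borel" by simp
  then have "(\<lambda>x. ennreal_powr x a) \<in> borel_measurable borel"
    unfolding ennreal_powr_def by (intro measurable_If) simp_all
  from measurable_compose[OF assms this] show ?thesis .
qed

text \<open>Hoelder's inequality in the weak form \<open>t \<le> a + a powr (1 - r) * t powr r\<close>: a function with a fixed
  integral whose support is small has a large norm.\<close>

lemma Lp_norm_large_of_small_support:
  fixes p :: ennreal and c K :: real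
  assumes p: "1 < p" and c: "0 < c" and K: "0 < K"
  obtains \<epsilon> where "\<epsilon> > 0"
    "\<And>(M :: 'a measure) F A. A \<in> sets M \<Longrightarrow> emeasure M A \<le> ennreal \<epsilon> \<Longrightarrow> F \<in> borel_measurable M \<Longrightarrow>
       (\<And>x. F x \<noteq> \<top>) \<Longrightarrow> (\<And>x. x \<in> space M \<Longrightarrow> x \<notin> A \<Longrightarrow> F x = 0) \<Longrightarrow>
       ennreal c \<le> (\<integral>\<^sup>+x. F x \<partial>M) \<Longrightarrow> \<not> Lp_norm p M F \<le> ennreal K"
proof (cases "p = \<top>")
  case True
  show ?thesis
  \<comment> \<open>An essential bound \<open>K\<close> on a support of this measure leaves an
    integral of at most \<open>c / 2\<close>.\<close>
  proof (rule that[of "c / (2 * K)"], goal_cases)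
    case 1
    show ?case using c K by simp
  next
    case (2 M F A)
    show ?case
    proof
      assume "Lp_norm p M F \<le> ennreal K"
      then have K': "esssup M F \<le> ennreal K" by (simp add: Lp_norm_def True)
      have "AE x in M. F x \<le> ennreal K * indicator A x"
        using esssup_AE[of F M] AE_space
      proof eventually_elim
        case (elim x)
        then show ?case using 2(5)[of x] K' by (cases "x \<in> A") (auto intro: order_trans)
      qed
      then have "(\<integral>\<^sup>+x. F x \<partial>M) \<le> (\<integral>\<^sup>+x. ennreal K * indicator A x \<partial>M)"
        by (rule nn_integral_mono_AE)
      also have "\<dots> = ennreal K * emeasure M A" using 2(1) by (simp add: nn_integral_cmult_indicator)
      also have "\<dots> \<le> ennreal K * ennreal (c / (2 * K))" by (intro mult_left_mono 2(2)) simp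
      also have "\<dots> = ennreal (c / 2)" using K c by (simp flip: ennreal_mult)
      finally have "ennreal c \<le> ennreal (c / 2)" using 2(6) by (rule order_trans[rotated])
      then show False using c by (simp add: ennreal_le_iff2)
    qed
  qed
next
  case False
  define r where "r = enn2real p"
  have "p = ennreal r" using False by (simp add: r_def less_top)
  then have r: "1 < r" using p by (simp add: one_less_ennreal)
  \<comment> \<open>The threshold solves \<open>a powr (1 - r) * K powr r = c / 4\<close>. A support
    of measure \<open>c / (4 * a)\<close> adds another \<open>c / 4\<close>, so the integral is at
    most \<open>c / 2\<close>.\<close>
  define a where "a = (4 * K powr r / c) powr (1 / (r - 1))"
  have a: "a > 0" using c K by (simp add: a_def)
  have ar: "a powr (1 - r) * K powr r = c / 4"
  proof -
    have "a powr (r - 1) = 4 * K powr r / c"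
      using r c K by (simp add: a_def powr_powr)
    moreover have "a powr (1 - r) = inverse (a powr (r - 1))"
      by (simp flip: powr_minus)
    ultimately have "a powr (1 - r) = inverse (4 * K powr r / c)" by (simp only:)
    then show ?thesis using c K by simp
  qed
  show ?thesis
  proof (rule that[of "c / (4 * a)"], goal_cases)
    case 1
    show ?case using c a by simp
  next
    case (2 M F A)
    note [measurable] = 2(1) 2(3)
    define N where "N = (\<integral>\<^sup>+x. ennreal_powr (F x) r \<partial>M)"
    show ?case
    proof
      assume "Lp_norm p M F \<le> ennreal K"
      then have NK: "ennreal_powr N (1 / r) \<le> ennreal K" using False by (simp add: Lp_norm_def r_def N_def)
      then have "N \<noteq> \<top>" by (auto simp: ennreal_powr_def top_unique)
      then obtain y where y: "N = ennreal y" "0 \<le> y" by (cases N) auto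
      have "y powr (1 / r) \<le> K" using NK y K by (simp add: ennreal_powr_ennreal ennreal_le_iff)
      then have "(y powr (1 / r)) powr r \<le> K powr r" using r by (intro powr_mono2) auto
      then have "y \<le> K powr r" using r y by (simp add: powr_powr)
      have "F x \<le> ennreal a * indicator A x + ennreal (a powr (1 - r)) * ennreal_powr (F x) r" if "x \<in> space M" for x
      proof (cases "x \<in> A")
        case True
        obtain t where t: "F x = ennreal t" "0 \<le> t" using 2(4)[of x] by (cases "F x") auto
        have "t \<le> a + a powr (1 - r) * t powr r"
        proof (cases "t \<le> a")
          case False
          then have "t powr (1 - r) \<le> a powr (1 - r)" using a r by (intro powr_mono2') auto
          then have "t powr (1 - r) * t powr r \<le> a powr (1 - r) * t powr r" by (intro mult_right_mono) auto
          then show ?thesis using False a by (simp add: powr_add[symmetric])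
        qed (simp add: add_increasing2)
        then have "ennreal t \<le> ennreal (a + a powr (1 - r) * t powr r)" by (rule ennreal_leI)
        then show ?thesis using True t a by (simp add: ennreal_powr_ennreal ennreal_mult)
      qed (use 2(5)[OF that] in simp)
      then have "(\<integral>\<^sup>+x. F x \<partial>M)
          \<le> (\<integral>\<^sup>+x. ennreal a * indicator A x + ennreal (a powr (1 - r)) * ennreal_powr (F x) r \<partial>M)"
        by (rule nn_integral_mono)
      also have "\<dots> = ennreal a * emeasure M A + ennreal (a powr (1 - r)) * N"
        unfolding N_def by (subst nn_integral_add) (auto simp: nn_integral_cmult nn_integral_cmult_indicator)
      also have "\<dots> \<le> ennreal a * ennreal (c / (4 * a)) + ennreal (a powr (1 - r)) * ennreal (K powr r)"
        using \<open>y \<le> K powr r\<close> unfolding y(1) by (intro add_mono mult_left_mono 2(2) ennreal_leI) auto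
      also have "\<dots> = ennreal (a * (c / (4 * a))) + ennreal (a powr (1 - r) * K powr r)"
        using a c by (simp only: ennreal_mult[symmetric] ennreal_mult'[symmetric] powr_ge_zero less_imp_le divide_nonneg_nonneg)
      also have "\<dots> = ennreal (c / 4) + ennreal (c / 4)"
        using a unfolding ar by simp
      also have "\<dots> = ennreal (c / 2)" using c by (simp flip: ennreal_plus)
      finally have "ennreal c \<le> ennreal (c / 2)" using 2(6) by (rule order_trans[rotated])
      then show False using c by (simp add: ennreal_le_iff2)
    qed
  qed
qed

section \<open>Statement (ii): the maximal function\<close>

lemma sl2_maximal_indicator_ge_1:
  assumes \<delta>: "0 < \<delta>" and T: "sl2_tube T" and E: "E \<in> sets borel" "tube_set \<delta> T \<subseteq> E"
  shows "1 \<le> sl2_maximal \<delta> (indicator E) (dir T)"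
proof -
  have n: "norm (dir T) = 1" using T by (simp add: sl2_tube_def)
  let ?T = "tube_set \<delta> T"
  have "(\<integral>\<^sup>+ x\<in>?T. ennreal \<bar>indicator E x\<bar> \<partial>lborel) = (\<integral>\<^sup>+ x. indicator ?T x \<partial>lborel)"
    using E(2) by (intro nn_integral_cong) (auto split: split_indicator)
  also have "\<dots> = emeasure lborel ?T"
    using closed_tube_set[OF n] by (intro nn_integral_indicator) (simp add: borel_closed)
  finally have "(\<integral>\<^sup>+ x\<in>?T. ennreal \<bar>indicator E x\<bar> \<partial>lborel) / emeasure lborel ?T = 1"
    using emeasure_tube_set_pos_finite[OF n \<delta>] by (simp add: ennreal_divide_self less_top)
  moreover have "(\<integral>\<^sup>+ x\<in>?T. ennreal \<bar>indicator E x\<bar> \<partial>lborel) / emeasure lborel ?T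
      \<le> sl2_maximal \<delta> (indicator E) (dir T)"
    unfolding sl2_maximal_def using T by (intro SUP_upper) simp
  ultimately show ?thesis by simp
qed

text \<open>The maximal function of the indicator of \<open>E\<close> is at least 1 on the
  directions covered by compression, while the norm of the indicator is at most
  \<open>\<epsilon> powr (1 / r)\<close>, which is arbitrarily small; a bounded constant cannot
  bridge the two.\<close>

lemma sl2_maximal_norm_blowup:
  fixes U :: "(real ^ 3) set" and p :: ennreal and C :: "real \<Rightarrow> real"
  assumes U: "U \<in> sets borel" "U \<subseteq> sphere 0 1 - {vector [0, 0, 1], vector [0, 0, - 1]}"
    "emeasure (hausdorff_measure 2) U > 0"
    and p: "1 \<le> p" "p < \<top>"
    and C: "\<And>\<delta> f. \<delta> > 0 \<Longrightarrow> f \<in> borel_measurable borel \<Longrightarrow> (\<And>x. 0 \<le> f x) \<Longrightarrow>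
       Lp_norm p (restrict_space (hausdorff_measure 2) U) (sl2_maximal \<delta> f)
         \<le> ennreal (C \<delta>) * Lp_norm p lborel (\<lambda>x. ennreal (f x))"
  shows "filterlim C at_top (at_right 0)"
proof -
  let ?H = "hausdorff_measure 2 :: (real ^ 3) measure"
  define r where "r = enn2real p"
  have "p = ennreal r" using p by (simp add: r_def less_top)
  then have r: "1 \<le> r" using p by (simp add: ennreal_ge_1)
  have Lp: "Lp_norm p M f = ennreal_powr (\<integral>\<^sup>+ x. ennreal_powr (f x) r \<partial>M) (1 / r)" for M and f :: "real ^ 3 \<Rightarrow> ennreal"
    using less_imp_neq[OF p(2)] by (simp add: Lp_norm_def r_def)
  have pole: "(e $ 1)\<^sup>2 + (e $ 2)\<^sup>2 > 0" if "e \<in> U" for e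
  proof (rule ccontr)
    assume "\<not> ?thesis"
    then have e0: "e $ 1 = 0" "e $ 2 = 0" by (auto simp: not_less sum_power2_le_zero_iff)
    have "norm e ^ 2 = 1" using that U(2) by auto
    then have "(e $ 3)\<^sup>2 = 1"
      unfolding power2_norm_eq_inner using e0 by (simp add: inner_vec_def sum_3 power2_eq_square)
    then have "e $ 3 = 1 \<or> e $ 3 = - 1" by (simp add: power2_eq_1_iff)
    then have "e = vector [0, 0, 1] \<or> e = vector [0, 0, - 1]" using e0 by (auto simp: vec3_eq_iff)
    then show False using that U(2) by blast
  qed
  define q where "q e = \<bar>e $ 3 / sqrt ((e $ 1)\<^sup>2 + (e $ 2)\<^sup>2)\<bar>" for e :: "real ^ 3"
  have [measurable]: "q \<in> borel_measurable borel" unfolding q_def by measurable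
  \<comment> \<open>Compression needs bounded slopes, but slopes blow up near the poles. Since the
    sets \<open>V m\<close> exhaust \<open>U\<close>, one of them has positive measure.\<close>
  define V where "V m = U \<inter> {e. q e \<le> real m}" for m :: nat
  have Vs: "V m \<in> sets ?H" for m
    using U(1) unfolding V_def sets_hausdorff_measure by measurable
  have "\<exists>m. emeasure ?H (V m) \<noteq> 0"
  proof (rule ccontr)
    assume "\<not> ?thesis"
    then have "(\<Union>m. V m) \<in> null_sets ?H" using Vs by (intro null_sets_UN) auto
    moreover have "U = (\<Union>m. V m)" using real_arch_simple by (auto simp: V_def)
    ultimately show False using U(3) by auto
  qed
  then obtain m where m: "emeasure ?H (V m) > 0" by (auto simp: zero_less_iff_neq_zero)
  define v where "v = ennreal_powr (emeasure ?H (V m)) (1 / r)"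
  have "v > 0"
    using m by (auto simp: v_def ennreal_powr_def enn2real_eq_0_iff zero_less_iff_neq_zero)
  \<comment> \<open>\<open>v\<close> is treated as possibly infinite; a positive real below it
    suffices.\<close>
  then obtain w where w: "0 < w" "ennreal w \<le> v"
    by (cases v) (auto intro: that[of 1] that)
  show ?thesis
    unfolding filterlim_at_top_gt[where c = 0] eventually_at_right_field
  proof (intro allI impI)
    fix K :: real assume K: "0 < K"
    \<comment> \<open>Chosen so that \<open>K * \<epsilon> powr (1 / r) = w / 2\<close>, which falls
      short of the lower bound \<open>w\<close>.\<close>
    define \<epsilon> where "\<epsilon> = (w / (2 * K)) powr r"
    have "\<epsilon> > 0" using w K by (simp add: \<epsilon>_def)
    obtain d E where d: "d > 0" and E: "E \<in> sets borel" "emeasure lborel E \<le> ennreal \<epsilon>"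
      "\<And>e. norm e = 1 \<Longrightarrow> (e $ 1)\<^sup>2 + (e $ 2)\<^sup>2 > 0 \<Longrightarrow> q e \<le> m \<Longrightarrow>
         \<exists>T. sl2_tube T \<and> dir T = e \<and> tube_set d T \<subseteq> E \<and> norm (fst T) \<le> q e + \<epsilon>"
      by (rule sl2_compression[OF \<open>\<epsilon> > 0\<close> of_nat_0_le_iff[of m], folded q_def]) (rule that; blast)
    have "K \<le> C \<delta>" if \<delta>: "0 < \<delta>" "\<delta> < d" for \<delta>
    proof (rule ccontr)
      assume "\<not> K \<le> C \<delta>"
      have max: "1 \<le> sl2_maximal \<delta> (indicator E) e" if "e \<in> V m" for e
      proof -
        have e: "e \<in> U" "q e \<le> m" using that by (auto simp: V_def)
        have "norm e = 1" using e(1) U(2) by auto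
        then obtain T where T: "sl2_tube T" "dir T = e" "tube_set d T \<subseteq> E"
          using E(3)[OF _ pole[OF e(1)] e(2)] by blast
        have "tube_set \<delta> T \<subseteq> E" using T(3) tube_set_mono[of \<delta> d T] \<delta> by simp
        then show ?thesis using sl2_maximal_indicator_ge_1[OF \<delta>(1) T(1) E(1)] T(2) by simp
      qed
      have "emeasure ?H (V m) = (\<integral>\<^sup>+ e. indicator (V m) e \<partial>?H)"
        using Vs by simp
      also have "\<dots> \<le> (\<integral>\<^sup>+ e. ennreal_powr (sl2_maximal \<delta> (indicator E) e) r * indicator U e \<partial>?H)"
      proof (rule nn_integral_mono)
        fix e
        have "ennreal_powr 1 r \<le> ennreal_powr (sl2_maximal \<delta> (indicator E) e) r" if "e \<in> V m"
          using max[OF that] r by (intro ennreal_powr_mono) auto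
        then show "indicator (V m) e \<le> ennreal_powr (sl2_maximal \<delta> (indicator E) e) r * indicator U e"
          by (auto simp: ennreal_powr_def V_def split: split_indicator)
      qed
      also have "\<dots> = (\<integral>\<^sup>+ e. ennreal_powr (sl2_maximal \<delta> (indicator E) e) r \<partial>restrict_space ?H U)"
        using U(1) by (intro nn_integral_restrict_space[symmetric]) simp
      finally have "v \<le> Lp_norm p (restrict_space ?H U) (sl2_maximal \<delta> (indicator E))"
        unfolding v_def Lp using r by (intro ennreal_powr_mono) auto
      also have "\<dots> \<le> ennreal (C \<delta>) * Lp_norm p lborel (\<lambda>x. ennreal (indicator E x))"
        using E(1) by (intro C \<delta>) auto
      also have "Lp_norm p lborel (\<lambda>x. ennreal (indicator E x)) = ennreal_powr (emeasure lborel E) (1 / r)"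
      proof -
        have "ennreal_powr (ennreal (indicator E x)) r = indicator E x" for x :: "real ^ 3"
          using r by (auto simp: ennreal_powr_def split: split_indicator)
        then show ?thesis using E(1) by (simp add: Lp)
      qed
      also have "ennreal (C \<delta>) * ennreal_powr (emeasure lborel E) (1 / r) \<le> ennreal K * ennreal_powr (ennreal \<epsilon>) (1 / r)"
        using \<open>\<not> K \<le> C \<delta>\<close> E(2) r by (intro mult_mono ennreal_leI ennreal_powr_mono) auto
      also have "\<dots> = ennreal (w / 2)"
        using w K r by (simp add: ennreal_powr_ennreal \<epsilon>_def powr_powr flip: ennreal_mult)
      finally have "ennreal w \<le> ennreal (w / 2)" using w(2) by (rule order_trans[rotated])
      then show False using w(1) by (simp add: ennreal_le_iff2)
    qed
    with d show "\<exists>b>0. \<forall>y>0. y < b \<longrightarrow> K \<le> C y" by blast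
  qed
qed

section \<open>Statement (i): separated directions and overlapping tubes\<close>

lemma normalized_direction_separation:
  fixes u v u' v' :: real
  assumes uv: "u \<in> {0..1/8}" "v \<in> {0..1/8}" "u' \<in> {0..1/8}" "v' \<in> {0..1/8}"
    and "16 * \<delta> \<le> \<bar>u - u'\<bar> \<or> 16 * \<delta> \<le> \<bar>v - v'\<bar>"
  shows "\<delta> \<le> dist (sgn (vector [1, u, v] :: real ^ 3)) (sgn (vector [1, u', v']))"
proof -
  have *: "16 * \<delta> \<le> 8 * dist e e'"
    if "e = sgn (vector [1, u, v] :: real ^ 3)" "e' = sgn (vector [1, u', v'] :: real ^ 3)" for e e'
  proof -
    define \<rho> \<rho>' where "\<rho> = norm (vector [1, u, v] :: real ^ 3)" and "\<rho>' = norm (vector [1, u', v'] :: real ^ 3)"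
    have "s\<^sup>2 \<le> 1" if "s \<in> {0..1/8}" for s :: real using that by (auto intro: power_le_one)
    from this[OF uv(1)] this[OF uv(2)] this[OF uv(3)] this[OF uv(4)]
    have "sqrt 1 \<le> \<rho>" "\<rho> \<le> sqrt (2\<^sup>2)" "sqrt 1 \<le> \<rho>'" "\<rho>' \<le> sqrt (2\<^sup>2)"
      unfolding \<rho>_def \<rho>'_def norm_vector_3 by (intro real_sqrt_le_mono; simp)+
    then have \<rho>: "1 \<le> \<rho>" "\<rho> \<le> 2" "1 \<le> \<rho>'" "\<rho>' \<le> 2" by simp_all
    have e: "e $ 1 = 1 / \<rho>" "e $ 2 = u / \<rho>" "e $ 3 = v / \<rho>"
      "e' $ 1 = 1 / \<rho>'" "e' $ 2 = u' / \<rho>'" "e' $ 3 = v' / \<rho>'"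
      unfolding that sgn_div_norm by (simp_all add: \<rho>_def \<rho>'_def divide_inverse mult.commute)
    have d: "\<bar>e $ i - e' $ i\<bar> \<le> dist e e'" for i
      using component_le_norm_cart[of "e - e'" i] by (simp add: dist_norm)
    \<comment> \<open>The first components \<open>1 / \<rho>\<close> and \<open>1 / \<rho>'\<close>
      control the change of normalisation, so undoing it costs only a bounded factor.\<close>
    have main: "\<bar>s - s'\<bar> \<le> 8 * dist e e'"
      if s: "\<bar>s / \<rho> - s' / \<rho>'\<bar> \<le> dist e e'" "s' \<in> {0..1/8}" for s s'
    proof -
      have "s - s' = \<rho> * ((s / \<rho> - s' / \<rho>') - s' * (1 / \<rho> - 1 / \<rho>'))"
        using \<rho> by (simp add: field_simps)
      then have "\<bar>s - s'\<bar> = \<rho> * \<bar>(s / \<rho> - s' / \<rho>') - s' * (1 / \<rho> - 1 / \<rho>')\<bar>"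
        using \<rho> by (simp add: abs_mult)
      also have "\<dots> \<le> 2 * (2 * dist e e')"
      proof (intro mult_mono)
        have "\<bar>s'\<bar> * \<bar>1 / \<rho> - 1 / \<rho>'\<bar> \<le> 1 * dist e e'"
          using d[of 1] s(2) unfolding e by (intro mult_mono) auto
        then have "\<bar>s' * (1 / \<rho> - 1 / \<rho>')\<bar> \<le> dist e e'" by (simp add: abs_mult)
        then show "\<bar>(s / \<rho> - s' / \<rho>') - s' * (1 / \<rho> - 1 / \<rho>')\<bar> \<le> 2 * dist e e'"
          using s(1) by linarith
      qed (use \<rho> in auto)
      finally show ?thesis using zero_le_dist[of e e'] by linarith
    qed
    show ?thesis
      using assms(5) main[OF _ uv(3), of u] main[OF _ uv(4), of v] d[of 2] d[of 3] unfolding e by linarith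
  qed
  show ?thesis using *[OF refl refl] zero_le_dist[of "sgn (vector [1, u, v] :: real ^ 3)" "sgn (vector [1, u', v'])"] by linarith
qed

text \<open>Both first components are at least \<open>1 / 2\<close>, so they add up to at least 1.
  This handles the opposite signs in \<open>directions_separated\<close>.\<close>

lemma normalized_direction_antipodal:
  fixes u v u' v' :: real
  assumes uv: "u \<in> {0..1/8}" "v \<in> {0..1/8}" "u' \<in> {0..1/8}" "v' \<in> {0..1/8}" 
  shows "1 \<le> dist (sgn (vector [1, u, v] :: real ^ 3)) (- sgn (vector [1, u', v']))"
proof -
  have *: "1 / 2 \<le> sgn (vector [1, u, v] :: real ^ 3) $ 1" if "u \<in> {0..1/8}" "v \<in> {0..1/8}" for u v :: real
  proof -
    have "s\<^sup>2 \<le> 1" if "s \<in> {0..1/8}" for s :: real using that by (auto intro: power_le_one)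
    from this[OF that(1)] this[OF that(2)]
    have "sqrt 1 \<le> norm (vector [1, u, v] :: real ^ 3)" "norm (vector [1, u, v] :: real ^ 3) \<le> sqrt (2\<^sup>2)"
      unfolding norm_vector_3 by (intro real_sqrt_le_mono; simp)+
    then have "1 \<le> norm (vector [1, u, v] :: real ^ 3)" "norm (vector [1, u, v] :: real ^ 3) \<le> 2"
      by simp_all
    then have "1 / 2 \<le> 1 / norm (vector [1, u, v] :: real ^ 3)"
      by (intro divide_left_mono mult_pos_pos) linarith+
    then show ?thesis by (simp add: sgn_div_norm inverse_eq_divide)
  qed
  have "\<bar>(sgn (vector [1, u, v] :: real ^ 3) - (- sgn (vector [1, u', v']))) $ 1\<bar>
      \<le> dist (sgn (vector [1, u, v] :: real ^ 3)) (- sgn (vector [1, u', v']))"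
    unfolding dist_norm by (rule component_le_norm_cart)
  then show ?thesis using *[OF uv(1,2)] *[OF uv(3,4)] by simp
qed

text \<open>The slope has modulus \<open>\<bar>v\<bar> / sqrt (1 + u^2)\<close>; bounding
  \<open>v\<close> thus places all grid directions within reach of compression.\<close>

lemma normalized_direction_slope:
  fixes u v :: real
  defines "e \<equiv> sgn (vector [1, u, v] :: real ^ 3)"
  shows "norm e = 1" "(e $ 1)\<^sup>2 + (e $ 2)\<^sup>2 > 0" "\<bar>e $ 3 / sqrt ((e $ 1)\<^sup>2 + (e $ 2)\<^sup>2)\<bar> \<le> \<bar>v\<bar>"
proof -
  define \<rho> where "\<rho> = norm (vector [1, u, v] :: real ^ 3)"
  have nz: "vector [1, u, v] \<noteq> (0 :: real ^ 3)" by (simp add: vec3_eq_iff)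
  then have \<rho>: "\<rho> > 0" by (simp add: \<rho>_def)
  show "norm e = 1" unfolding e_def norm_sgn using nz by simp
  have e: "e $ 1 = 1 / \<rho>" "e $ 2 = u / \<rho>" "e $ 3 = v / \<rho>"
    unfolding e_def sgn_div_norm by (simp_all add: \<rho>_def divide_inverse mult.commute)
  show "(e $ 1)\<^sup>2 + (e $ 2)\<^sup>2 > 0" using \<rho> unfolding e by (intro add_pos_nonneg) auto
  have "(e $ 1)\<^sup>2 + (e $ 2)\<^sup>2 = (1 + u\<^sup>2) / \<rho>\<^sup>2"
    unfolding e by (simp add: power_divide add_divide_distrib)
  then have "sqrt ((e $ 1)\<^sup>2 + (e $ 2)\<^sup>2) = sqrt (1 + u\<^sup>2) / \<rho>" using \<rho> by (simp add: real_sqrt_divide)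
  then have "\<bar>e $ 3 / sqrt ((e $ 1)\<^sup>2 + (e $ 2)\<^sup>2)\<bar> = \<bar>v\<bar> / sqrt (1 + u\<^sup>2)"
    using \<rho> unfolding e(3) by (simp add: abs_divide)
  also have "\<dots> \<le> \<bar>v\<bar> / 1" by (intro divide_left_mono) (simp_all add: add_pos_nonneg)
  finally show "\<bar>e $ 3 / sqrt ((e $ 1)\<^sup>2 + (e $ 2)\<^sup>2)\<bar> \<le> \<bar>v\<bar>" by simp
qed

text \<open>About \<open>\<delta>\<close> to the power -2 compressed tubes, each of volume at least
  a constant times \<open>\<delta>^2\<close>, give an overlap function whose integral is bounded
  below independently of \<delta>, while its support lies in the small set \<open>E\<close>.\<close>

lemma sl2_tube_overlap_norm_blowup:
  fixes p :: ennreal and C :: "real \<Rightarrow> real"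
  assumes p: "1 < p"
    and C: "\<And>\<delta> TT. \<delta> > 0 \<Longrightarrow> \<forall>T\<in>TT. sl2_tube T \<Longrightarrow> directions_separated \<delta> TT \<Longrightarrow>
       Lp_norm p (restrict_space lborel (ball 0 1)) (\<lambda>x. \<Sum>T\<in>TT. indicator (tube_set \<delta> T) x)
         \<le> ennreal (C \<delta>)"
  shows "filterlim C at_top (at_right 0)"
  unfolding filterlim_at_top_gt[where c = 0] eventually_at_right_field
proof (intro allI impI)
  fix K :: real assume K: "0 < K"
  define b where "b = unit_ball_vol 3 / 8"
  \<comment> \<open>The lower bound for the integral: \<open>m^2\<close> tubes of volume at least
    \<open>b * \<delta>^2\<close>, with \<open>m * \<delta> \<ge> 1 / 256\<close>.\<close>
  define c where "c = b * (1 / 256)\<^sup>2"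
  have b: "b > 0" by (simp add: b_def)
  then have c: "c > 0" by (simp add: c_def)
  let ?B = "restrict_space lborel (ball 0 1) :: (real ^ 3) measure"
  obtain \<epsilon> where "\<epsilon> > 0" and \<epsilon>: "\<And>(M :: (real ^ 3) measure) F A. A \<in> sets M \<Longrightarrow> emeasure M A \<le> ennreal \<epsilon> \<Longrightarrow>
      F \<in> borel_measurable M \<Longrightarrow> (\<And>x. F x \<noteq> \<top>) \<Longrightarrow> (\<And>x. x \<in> space M \<Longrightarrow> x \<notin> A \<Longrightarrow> F x = 0) \<Longrightarrow>
      ennreal c \<le> (\<integral>\<^sup>+x. F x \<partial>M) \<Longrightarrow> \<not> Lp_norm p M F \<le> ennreal K"
    using Lp_norm_large_of_small_support[OF p c K, where ?'a = "real ^ 3"] by blast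
  \<comment> \<open>The cap \<open>1 / 16\<close> keeps the tubes in the unit ball:
    \<open>1 / 8 + 1 / 16\<close> for the midpoint and \<open>1 / 2 + 1 / 256\<close> for the extent
    add up to less than 1.\<close>
  define \<eta> where "\<eta> = min \<epsilon> (1 / 16)"
  have \<eta>: "\<eta> > 0" "\<eta> \<le> \<epsilon>" "\<eta> \<le> 1 / 16" using \<open>\<epsilon> > 0\<close> by (auto simp: \<eta>_def)
  define q where "q e = \<bar>e $ 3 / sqrt ((e $ 1)\<^sup>2 + (e $ 2)\<^sup>2)\<bar>" for e :: "real ^ 3"
  obtain d E where d: "d > 0" and E: "E \<in> sets borel" "emeasure lborel E \<le> ennreal \<eta>"
    "\<And>e. norm e = 1 \<Longrightarrow> (e $ 1)\<^sup>2 + (e $ 2)\<^sup>2 > 0 \<Longrightarrow> q e \<le> 1 / 8 \<Longrightarrow>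
       \<exists>T. sl2_tube T \<and> dir T = e \<and> tube_set d T \<subseteq> E \<and> norm (fst T) \<le> q e + \<eta>"
    by (rule sl2_compression[OF \<eta>(1) divide_nonneg_pos[of 1 8], folded q_def]) (simp, simp, (rule that; blast))
  have "K \<le> C \<delta>" if \<delta>: "0 < \<delta>" "\<delta> < min d (1 / 256)" for \<delta>
  proof (rule ccontr)
    assume CK: "\<not> K \<le> C \<delta>"
    \<comment> \<open>Number of grid points of spacing \<open>16 * \<delta>\<close> per coordinate
      in \<open>[0, 1 / 8]\<close>. As \<open>\<delta> < 1 / 256\<close>, rounding down loses at
      most a factor 2.\<close>
    define m where "m = nat \<lfloor>1 / (128 * \<delta>)\<rfloor>"
    have "real m = \<lfloor>1 / (128 * \<delta>)\<rfloor>" using \<delta> by (simp add: m_def)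
    then have "m \<le> 1 / (128 * \<delta>)" "1 / (128 * \<delta>) < m + 1" by linarith+
    moreover have "1 \<le> 1 / (256 * \<delta>)" "1 / (128 * \<delta>) = 2 * (1 / (256 * \<delta>))"
      using \<delta> by (simp_all add: field_simps)
    ultimately have "m \<le> 1 / (128 * \<delta>)" "1 / (256 * \<delta>) \<le> m" by linarith+
    then have m: "16 * \<delta> * m \<le> 1 / 8" "1 / 256 \<le> m * \<delta>" using \<delta> by (simp_all add: field_simps)
    define G where "G = {..<m} \<times> {..<m}"
    define e where "e g = sgn (vector [1, 16 * \<delta> * real (fst g), 16 * \<delta> * real (snd g)] :: real ^ 3)" for g :: "nat \<times> nat"
    have coord: "16 * \<delta> * real i \<in> {0..1/8}" if "i < m" for i
    proof -
      have "16 * \<delta> * real i \<le> 16 * \<delta> * m" using that \<delta> by (intro mult_left_mono) auto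
      then have "16 * \<delta> * real i \<le> 1 / 8" using m(1) by (rule order_trans)
      then show ?thesis using \<delta>(1) by (simp only: atLeastAtMost_iff) simp
    qed
    have sep: "\<delta> \<le> dist (e g) (e g')" if "g \<in> G" "g' \<in> G" "g \<noteq> g'" for g g'
    proof -
      have sp: "16 * \<delta> \<le> \<bar>16 * \<delta> * real i - 16 * \<delta> * real j\<bar>" if "i \<noteq> j" for i j :: nat
      proof -
        have "16 * \<delta> * 1 \<le> 16 * \<delta> * \<bar>real i - real j\<bar>" using that \<delta> by (intro mult_left_mono) auto
        also have "\<dots> = \<bar>16 * \<delta> * real i - 16 * \<delta> * real j\<bar>"
          using \<delta> by (simp add: abs_mult flip: right_diff_distrib)
        finally show ?thesis by simp
      qed
      have "fst g \<noteq> fst g' \<or> snd g \<noteq> snd g'" using that(3) by (auto simp: prod_eq_iff)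
      then show ?thesis
        unfolding e_def using that(1,2) sp
        by (intro normalized_direction_separation coord) (auto simp: G_def)
    qed
    have anti: "\<delta> \<le> dist (e g) (- e g')" if "g \<in> G" "g' \<in> G" for g g'
    proof -
      have "1 \<le> dist (e g) (- e g')"
        unfolding e_def using that by (intro normalized_direction_antipodal coord) (auto simp: G_def)
      then show ?thesis using \<delta> by simp
    qed
    have "\<exists>T. sl2_tube T \<and> dir T = e g \<and> tube_set d T \<subseteq> E \<and> norm (fst T) \<le> 1 / 8 + \<eta>" if "g \<in> G" for g
    proof -
      have "snd g < m" using that by (auto simp: G_def)
      then have "\<bar>16 * \<delta> * real (snd g)\<bar> \<le> 1 / 8"
        using coord[of "snd g"] by (simp only: atLeastAtMost_iff abs_of_nonneg)
      then have "q (e g) \<le> 1 / 8"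
        unfolding q_def e_def by (rule order_trans[OF normalized_direction_slope(3)])
      moreover have "norm (e g) = 1" "(e g $ 1)\<^sup>2 + (e g $ 2)\<^sup>2 > 0"
        unfolding e_def by (rule normalized_direction_slope)+
      ultimately obtain T where "sl2_tube T" "dir T = e g" "tube_set d T \<subseteq> E" "norm (fst T) \<le> q (e g) + \<eta>"
        using E(3) by blast
      then show ?thesis using \<open>q (e g) \<le> 1 / 8\<close> by (intro exI[of _ T]) auto
    qed
    then obtain T where T: "\<And>g. g \<in> G \<Longrightarrow> sl2_tube (T g)" "\<And>g. g \<in> G \<Longrightarrow> dir (T g) = e g"
      "\<And>g. g \<in> G \<Longrightarrow> tube_set d (T g) \<subseteq> E" "\<And>g. g \<in> G \<Longrightarrow> norm (fst (T g)) \<le> 1 / 8 + \<eta>"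
      by metis
    have n: "norm (dir (T g)) = 1" if "g \<in> G" for g using T(1)[OF that] by (simp add: sl2_tube_def)
    \<comment> \<open>The inequality concerns a set of tubes; injectivity identifies its sum with
      the sum over the index grid.\<close>
    have inj: "inj_on T G"
    proof (rule inj_onI, rule ccontr)
      fix g g' assume g: "g \<in> G" "g' \<in> G" "T g = T g'" "g \<noteq> g'"
      then have "e g = e g'" using T(2) by metis
      then show False using sep[OF g(1,2,4)] \<delta>(1) by simp
    qed
    have "directions_separated \<delta> (T ` G)"
      unfolding directions_separated_def
    proof (intro ballI impI)
      fix T1 T2 assume "T1 \<in> T ` G" "T2 \<in> T ` G" "T1 \<noteq> T2"
      then obtain g g' where "g \<in> G" "g' \<in> G" "g \<noteq> g'" "T1 = T g" "T2 = T g'" by blast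
      then show "\<delta> \<le> dist (dir T1) (dir T2) \<and> \<delta> \<le> dist (dir T1) (- dir T2)"
        using sep anti by (simp add: T(2))
    qed
    then have "Lp_norm p ?B (\<lambda>x. \<Sum>T\<in>T ` G. indicator (tube_set \<delta> T) x) \<le> ennreal (C \<delta>)"
      using T(1) \<delta> by (intro C) auto
    also have "\<dots> \<le> ennreal K" using CK by (intro ennreal_leI) simp
    finally have le: "Lp_norm p ?B (\<lambda>x. \<Sum>T\<in>T ` G. indicator (tube_set \<delta> T) x) \<le> ennreal K" .
    define F :: "real ^ 3 \<Rightarrow> ennreal" where "F x = (\<Sum>g\<in>G. indicator (tube_set \<delta> (T g)) x)" for x
    have F: "(\<lambda>x. \<Sum>T\<in>T ` G. indicator (tube_set \<delta> T) x) = F"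
      unfolding F_def by (intro ext) (rule sum.reindex_cong[OF inj], simp_all)
    have tE: "tube_set \<delta> (T g) \<subseteq> E" if "g \<in> G" for g
      using T(3)[OF that] tube_set_mono[of \<delta> d "T g"] \<delta> by simp
    have tB: "tube_set \<delta> (T g) \<subseteq> ball 0 1" if "g \<in> G" for g
    proof
      fix x assume "x \<in> tube_set \<delta> (T g)"
      then have "dist (fst (T g)) x \<le> 1 / 2 + \<delta>"
        using tube_set_subset_cball[OF n[OF that]] by fastforce
      then show "x \<in> ball 0 1"
        using T(4)[OF that] \<eta>(3) \<delta>(2) dist_triangle[of 0 x "fst (T g)"] by (simp add: dist_norm)
    qed
    have ts: "tube_set \<delta> (T g) \<in> sets borel" if "g \<in> G" for g
      using closed_tube_set[OF n[OF that]] by (rule borel_closed)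
    have Fm: "F \<in> borel_measurable lborel"
      unfolding F_def using ts by (intro borel_measurable_sum borel_measurable_indicator) simp
    have "ennreal c \<le> (\<Sum>g\<in>G. ennreal (b * \<delta>\<^sup>2))"
    proof -
      have "c \<le> b * (m * \<delta>)\<^sup>2"
        unfolding c_def using m(2) b by (intro mult_left_mono power_mono) auto
      also have "\<dots> = real (card G) * (b * \<delta>\<^sup>2)" by (simp add: G_def power2_eq_square)
      finally have "ennreal c \<le> ennreal (real (card G) * (b * \<delta>\<^sup>2))" by (rule ennreal_leI)
      then show ?thesis using b by (simp add: ennreal_mult ennreal_of_nat_eq_real_of_nat)
    qed
    also have "\<dots> \<le> (\<Sum>g\<in>G. emeasure lborel (tube_set \<delta> (T g)))"
      unfolding b_def using \<delta> n by (intro sum_mono emeasure_tube_set_ge) auto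
    also have "\<dots> = (\<Sum>g\<in>G. \<integral>\<^sup>+ x. indicator (tube_set \<delta> (T g)) x \<partial>lborel)"
      using ts by (intro sum.cong) auto
    also have "\<dots> = (\<integral>\<^sup>+ x. F x \<partial>lborel)"
      unfolding F_def using ts by (intro nn_integral_sum[symmetric] borel_measurable_indicator) simp
    \<comment> \<open>All tubes lie in the unit ball, so restricting to it loses none of the
      integral.\<close>
    also have "\<dots> = (\<integral>\<^sup>+ x. F x * indicator (ball 0 1) x \<partial>lborel)"
    proof (rule nn_integral_cong)
      fix x
      show "F x = F x * indicator (ball 0 1) x"
      proof (cases "x \<in> ball 0 1")
        case False
        then have "x \<notin> tube_set \<delta> (T g)" if "g \<in> G" for g using tB[OF that] by blast
        then have "F x = 0" unfolding F_def by (intro sum.neutral) simp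
        then show ?thesis by simp
      qed simp
    qed
    also have "\<dots> = (\<integral>\<^sup>+ x. F x \<partial>?B)" by (intro nn_integral_restrict_space[symmetric]) simp
    finally have cF: "ennreal c \<le> (\<integral>\<^sup>+ x. F x \<partial>?B)" .
    have "\<not> Lp_norm p ?B F \<le> ennreal K"
    proof (rule \<epsilon>[of "E \<inter> ball 0 1"])
      show "E \<inter> ball 0 1 \<in> sets ?B" using E(1) by (subst sets_restrict_space_iff) auto
      have "emeasure ?B (E \<inter> ball 0 1) = emeasure lborel (E \<inter> ball 0 1)"
        by (subst emeasure_restrict_space) auto
      also have "\<dots> \<le> emeasure lborel E" using E(1) by (intro emeasure_mono) auto
      also have "\<dots> \<le> ennreal \<epsilon>" using E(2) \<eta>(2) ennreal_leI order_trans by blast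
      finally show "emeasure ?B (E \<inter> ball 0 1) \<le> ennreal \<epsilon>" .
      show "F \<in> borel_measurable ?B" using Fm by (rule measurable_restrict_space1)
      show "F x \<noteq> \<top>" for x
        unfolding F_def by (simp add: G_def indicator_def)
      show "F x = 0" if "x \<in> space ?B" "x \<notin> E \<inter> ball 0 1" for x
      proof -
        have "x \<notin> E" using that by (simp add: space_restrict_space)
        then have "x \<notin> tube_set \<delta> (T g)" if "g \<in> G" for g using tE[OF that] by blast
        then show ?thesis unfolding F_def by (intro sum.neutral) simp
      qed
      show "ennreal c \<le> (\<integral>\<^sup>+ x. F x \<partial>?B)" by (rule cF)
    qed
    then show False using le unfolding F by blast
  qed
  then show "\<exists>b>0. \<forall>y>0. y < b \<longrightarrow> K \<le> C y"
    using d by (intro exI[of _ "min d (1 / 256)"]) auto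
qed

theorem corollary2p3:
  shows
    "(\<forall>(p :: ennreal) (C :: real \<Rightarrow> real).
        1 < p \<longrightarrow>
        (\<forall>\<delta> > 0. \<forall>TT. (\<forall>T\<in>TT. sl2_tube T) \<and> directions_separated \<delta> TT \<longrightarrow>
           Lp_norm p (restrict_space lborel (ball 0 1)) (\<lambda>x. \<Sum>T\<in>TT. indicator (tube_set \<delta> T) x)
             \<le> ennreal (C \<delta>)) \<longrightarrow>
        filterlim C at_top (at_right 0)) \<and>
     (\<forall>(U :: (real ^ 3) set) (p :: ennreal) (C :: real \<Rightarrow> real).
        U \<in> sets borel \<and> U \<subseteq> sphere 0 1 - {vector [0, 0, 1], vector [0, 0, - 1]} \<and>
        emeasure (hausdorff_measure 2) U > 0 \<and>
        1 \<le> p \<and> p < \<top> \<longrightarrow>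
        (\<forall>\<delta> > 0. \<forall>f \<in> borel_measurable borel. (\<forall>x. 0 \<le> f x) \<longrightarrow>
           Lp_norm p (restrict_space (hausdorff_measure 2) U) (sl2_maximal \<delta> f)
             \<le> ennreal (C \<delta>) * Lp_norm p lborel (\<lambda>x. ennreal (f x))) \<longrightarrow>
        filterlim C at_top (at_right 0))"
proof (intro conjI allI impI, goal_cases)
  case (1 p C)
  show ?case by (rule sl2_tube_overlap_norm_blowup[OF 1(1)]) (use 1(2) in blast)
next
  case (2 U p C)
  then have U: "U \<in> sets borel" "U \<subseteq> sphere 0 1 - {vector [0, 0, 1], vector [0, 0, - 1]}"
    "emeasure (hausdorff_measure 2) U > 0" "1 \<le> p" "p < \<top>" by blast+
  show ?case by (rule sl2_maximal_norm_blowup[OF U]) (use 2(2) in blast)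
qed

end
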